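(* For a permutation $w\in S_n$, the Newton polytope $\mathrm{Newton}(\mathfrak{G}_w)$ of the Grothendieck polynomial is lattice-free if and only if $w$ avoids the patterns $1432$, $1423$, $13254$.
   Context: Grothendieck polynomials: with $\partial_i f=(f-s_if)/(x_i-x_{i+1})$ ($s_i$ swaps $x_i,x_{i+1}$), $\mathfrak{G}_{w_0}=x_1^{n-1}\cdots x_{n-1}$ for $w_0=n(n-1)\cdots1$, and $\mathfrak{G}_w=\partial_i((1-x_{i+1})\mathfrak{G}_{ws_i})$ whenever $w(i)<w(i+1)$ ($ws_i$ swaps the values in positions $i,i+1$). $\mathrm{Newton}(f)=\mathrm{conv}\{\alpha:c_\alpha\ne0\}$ for $f=\sum c_\alpha x^\alpha$. A polytope $P\subset\mathbb{R}^n$ is lattice-free if $P\cap\mathbb{Z}^n$ equals its vertex set. Pattern avoidance: $w$ contains $\tau\in S_k$ if some subsequence $w(i_1),\ldots,w(i_k)$ with $i_1<\cdots<i_k$ is order-isomorphic to $\tau$; otherwise it avoids $\tau$. *)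

theory Defs
  imports
    "HOL-Analysis.Analysis"
    "HOL-Combinatorics.Permutations"
    "HOL-Analysis.Finite_Function_Topology"
begin

section \<open>Polynomials in the variables $x_1, x_2, \ldots$\<close>

text \<open>
  An exponent vector is a finitely supported map from variable indices to naturals; a polynomial
  is a finitely supported map from exponent vectors to its integer coefficients.
\<close>

type_synonym mpoly = "(nat \<Rightarrow>\<^sub>0 nat) \<Rightarrow>\<^sub>0 int"

definition X :: "nat \<Rightarrow> mpoly"
  where "X i = Poly_Mapping.single (Poly_Mapping.single i 1) 1"

text \<open>The inner \<open>map_key\<close> permutes an exponent vector, the outer one relabels the monomials.\<close>

definition swap_vars :: "nat \<Rightarrow> mpoly \<Rightarrow> mpoly"
  where "swap_vars i f =
    Poly_Mapping.map_key (Poly_Mapping.map_key (Transposition.transpose i (i + 1))) f"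

text \<open>
  The quotient exists and is unique, see \<open>divided_difference_eq\<close> and
  \<open>divided_difference_unique\<close>.
\<close>

definition divided_difference :: "nat \<Rightarrow> mpoly \<Rightarrow> mpoly"
  where "divided_difference i f = (THE g. (X i - X (i + 1)) * g = f - swap_vars i f)"


section \<open>Grothendieck polynomials\<close>

definition longest_perm :: "nat \<Rightarrow> nat \<Rightarrow> nat"
  where "longest_perm n i = (if i \<in> {1..n} then n + 1 - i else i)"

text \<open>
  Elements of $S_n$ are functions \<open>w\<close> with \<open>w permutes {1..n}\<close>.  The relation contains every
  polynomial obtainable for \<open>w\<close> from the recursion, for whatever choice of ascents.
\<close>

inductive is_grothendieck :: "nat \<Rightarrow> (nat \<Rightarrow> nat) \<Rightarrow> mpoly \<Rightarrow> bool" for n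
  where
    longest: "is_grothendieck n (longest_perm n) (\<Prod>i\<in>{1..<n}. X i ^ (n - i))"
  | ascent: "w permutes {1..n} \<Longrightarrow> 1 \<le> i \<Longrightarrow> i < n \<Longrightarrow> w i < w (i + 1) \<Longrightarrow>
      is_grothendieck n (w \<circ> Transposition.transpose i (i + 1)) g \<Longrightarrow>
      is_grothendieck n w (divided_difference i ((1 - X (i + 1)) * g))"

text \<open>
  Well defined by \<open>ex1_is_grothendieck\<close>; the recursion in its usual form is
  \<open>grothendieck_longest\<close> and \<open>grothendieck_ascent\<close>.
\<close>

definition grothendieck :: "nat \<Rightarrow> (nat \<Rightarrow> nat) \<Rightarrow> mpoly"
  where "grothendieck n w = (THE g. is_grothendieck n w g)"


section \<open>Newton polytopes and lattice-freeness\<close>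

text \<open>
  The spaces $\mathbb{R}^n$ for all \<open>n\<close> are realised inside the real vector space of finitely
  supported maps, as the subspaces of maps supported on \<open>{1..n}\<close>.
\<close>

definition Newton :: "mpoly \<Rightarrow> (nat \<Rightarrow>\<^sub>0 real) set"
  where "Newton f = convex hull (Poly_Mapping.map real ` Poly_Mapping.keys f)"

definition integer_points :: "nat \<Rightarrow> (nat \<Rightarrow>\<^sub>0 real) set"
  where "integer_points n =
    {v. Poly_Mapping.keys v \<subseteq> {1..n} \<and> (\<forall>i. Poly_Mapping.lookup v i \<in> \<int>)}"

definition lattice_free :: "nat \<Rightarrow> (nat \<Rightarrow>\<^sub>0 real) set \<Rightarrow> bool"
  where "lattice_free n P \<longleftrightarrow> P \<inter> integer_points n = {v. v extreme_point_of P}"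


section \<open>Pattern avoidance\<close>

text \<open>Patterns are given in one-line notation.\<close>

definition contains_pattern :: "nat \<Rightarrow> (nat \<Rightarrow> nat) \<Rightarrow> nat list \<Rightarrow> bool"
  where "contains_pattern n w \<tau> \<longleftrightarrow>
    (\<exists>is. length is = length \<tau> \<and> sorted_wrt (<) is \<and> set is \<subseteq> {1..n} \<and>
      (\<forall>a<length \<tau>. \<forall>b<length \<tau>. w (is ! a) < w (is ! b) \<longleftrightarrow> \<tau> ! a < \<tau> ! b))"

abbreviation avoids_pattern :: "nat \<Rightarrow> (nat \<Rightarrow> nat) \<Rightarrow> nat list \<Rightarrow> bool"
  where "avoids_pattern n w \<tau> \<equiv> \<not> contains_pattern n w \<tau>"

section \<open>Well-definedness\<close>

lemma poly_mapping_decomp_induct: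
  fixes p :: "'a \<Rightarrow>\<^sub>0 'b::comm_monoid_add"
  assumes "P 0" and "\<And>k c. P (Poly_Mapping.single k c)"
    and "\<And>p q. P p \<Longrightarrow> P q \<Longrightarrow> P (p + q)"
  shows "P p"
proof -
  have eq: "p = (\<Sum>k\<in>Poly_Mapping.keys p. Poly_Mapping.single k (Poly_Mapping.lookup p k))"
    by (rule poly_mapping_eqI)
      (auto simp: lookup_sum lookup_single when_def in_keys_iff if_distrib cong: if_cong)
  have "P (\<Sum>k\<in>A. Poly_Mapping.single k (Poly_Mapping.lookup p k))" if "finite A" for A
    using that by induction (auto intro: assms)
  with eq show ?thesis by (metis finite_keys)
qed

lemma mpoly_induct [case_names const var add mult]:
  fixes f :: mpoly
  assumes const: "\<And>c. P (Poly_Mapping.single 0 c)" and var: "\<And>j. P (X j)"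
    and add: "\<And>f g. P f \<Longrightarrow> P g \<Longrightarrow> P (f + g)"
    and mult: "\<And>f g. P f \<Longrightarrow> P g \<Longrightarrow> P (f * g)"
  shows "P f"
proof (induction f rule: poly_mapping_decomp_induct)
  case 1
  show ?case using const[of 0] by simp
next
  case (2 \<alpha> c)
  have pow: "P (X j ^ k)" for j k
    by (induction k) (use const[of 1] in \<open>auto intro: var mult\<close>)
  have single_pow: "Poly_Mapping.single (Poly_Mapping.single j k) 1 = X j ^ k" for j k
  proof (induction k)
    case (Suc k)
    have "Poly_Mapping.single j (Suc k) = Poly_Mapping.single j 1 + Poly_Mapping.single j k"
      by (simp flip: single_add)
    have "Poly_Mapping.single (Poly_Mapping.single j (Suc k)) (1::int) =
        Poly_Mapping.single (Poly_Mapping.single j 1) 1 *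
        Poly_Mapping.single (Poly_Mapping.single j k) 1"
      by (simp only: \<open>Poly_Mapping.single j (Suc k) = _\<close> mult_single mult_1)
    with Suc show ?case by (simp only: X_def power_Suc)
  qed simp
  have "P (Poly_Mapping.single \<alpha> 1)"
  proof (induction \<alpha> rule: poly_mapping_decomp_induct)
    case 1
    show ?case using const[of 1] by simp
  next
    case (2 j k)
    show ?case by (simp only: single_pow pow)
  next
    case (3 \<alpha> \<beta>)
    have "Poly_Mapping.single (\<alpha> + \<beta>) (1::int) =
        Poly_Mapping.single \<alpha> 1 * Poly_Mapping.single \<beta> 1"
      by (simp add: mult_single)
    with 3 show ?case by (simp only: mult)
  qed
  moreover have "Poly_Mapping.single \<alpha> c = Poly_Mapping.single 0 c * Poly_Mapping.single \<alpha> 1"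
    by (simp add: mult_single)
  ultimately show ?case by (simp only: const mult)
next
  case (3 f g)
  then show ?case by (rule add)
qed

lemma inj_map_key_transpose:
  "inj (Poly_Mapping.map_key (Transposition.transpose a b) :: ('a \<Rightarrow>\<^sub>0 'b::zero) \<Rightarrow> _)"
proof (rule inj_on_inverseI)
  fix p :: "'a \<Rightarrow>\<^sub>0 'b"
  show "Poly_Mapping.map_key (Transposition.transpose a b)
      (Poly_Mapping.map_key (Transposition.transpose a b) p) = p"
    by (simp add: map_key_compose map_key_id comp_def)
qed

lemma map_key_transpose_add:
  "Poly_Mapping.map_key (Transposition.transpose a b) (p + q) =
    Poly_Mapping.map_key (Transposition.transpose a b) p +
    Poly_Mapping.map_key (Transposition.transpose a b) q"
  by (simp add: map_key_plus)

lemma map_key_transpose_transpose: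
  "Poly_Mapping.map_key (Transposition.transpose a b)
      (Poly_Mapping.map_key (Transposition.transpose a b) p) = p"
  by (simp add: map_key_compose map_key_id comp_def)

lemma map_key_transpose_single:
  "Poly_Mapping.map_key (Transposition.transpose a b) (Poly_Mapping.single k v) =
    Poly_Mapping.single (Transposition.transpose a b k) v"
  using map_key_single[of "Transposition.transpose a b" "Transposition.transpose a b k" v] by simp

lemma swap_vars_add: "swap_vars i (f + g) = swap_vars i f + swap_vars i g"
  by (simp add: swap_vars_def map_key_plus inj_map_key_transpose)

lemma swap_vars_single:
  "swap_vars i (Poly_Mapping.single \<alpha> c) =
    Poly_Mapping.single (Poly_Mapping.map_key (Transposition.transpose i (i + 1)) \<alpha>) c"
  using map_key_single[OF inj_map_key_transpose, of i "i + 1"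
      "Poly_Mapping.map_key (Transposition.transpose i (i + 1)) \<alpha>" c]
  by (simp only: swap_vars_def map_key_transpose_transpose)

lemma swap_vars_X: "swap_vars i (X j) = X (Transposition.transpose i (i + 1) j)"
  by (simp only: X_def swap_vars_single map_key_transpose_single)

lemma swap_vars_const: "swap_vars i (Poly_Mapping.single 0 c) = Poly_Mapping.single 0 c"
  by (simp add: swap_vars_single)

lemma swap_vars_0 [simp]: "swap_vars i 0 = 0"
  using swap_vars_const[of i 0] by simp

lemma swap_vars_1 [simp]: "swap_vars i 1 = 1"
  using swap_vars_const[of i 1] by simp

lemma swap_vars_diff: "swap_vars i (f - g) = swap_vars i f - swap_vars i g"
  using swap_vars_add[of i "f - g" g] by simp

lemma swap_vars_mult: "swap_vars i (f * g) = swap_vars i f * swap_vars i g"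
proof (induction f rule: poly_mapping_decomp_induct)
  case (2 \<alpha> c)
  show ?case
  proof (induction g rule: poly_mapping_decomp_induct)
    case (2 \<beta> d)
    show ?case by (simp only: mult_single swap_vars_single map_key_transpose_add)
  qed (simp_all add: swap_vars_add distrib_left)
qed (simp_all add: swap_vars_add distrib_right)

lemmas swap_vars_hom = swap_vars_add swap_vars_diff swap_vars_mult swap_vars_X

lemma swap_vars_involutory: "swap_vars i (swap_vars i f) = f"
  by (induction f rule: mpoly_induct) (simp_all add: swap_vars_const swap_vars_hom)

lemma swap_vars_commute:
  assumes "i + 1 < j"
  shows "swap_vars i (swap_vars j f) = swap_vars j (swap_vars i f)"
proof (induction f rule: mpoly_induct)
  case (var k)
  show ?case using assms by (simp add: swap_vars_X Transposition.transpose_def)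
qed (simp_all add: swap_vars_const swap_vars_hom)

lemma swap_vars_braid:
  "swap_vars i (swap_vars (i + 1) (swap_vars i f)) =
    swap_vars (i + 1) (swap_vars i (swap_vars (i + 1) f))"
proof (induction f rule: mpoly_induct)
  case (var k)
  show ?case by (simp add: swap_vars_X Transposition.transpose_def)
qed (simp_all add: swap_vars_const swap_vars_hom)

lemma X_eq_iff [simp]: "X i = X j \<longleftrightarrow> i = j"
proof
  assume "X i = X j"
  then have "Poly_Mapping.keys (X i) = Poly_Mapping.keys (X j)" by simp
  then have "Poly_Mapping.keys (Poly_Mapping.single i (1::nat)) =
      Poly_Mapping.keys (Poly_Mapping.single j (1::nat))"
    by (simp add: X_def)
  then show "i = j" by simp
qed simp

lemma diff_swap_vars_dvd: "X i - X (i + 1) dvd f - swap_vars i f"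
proof (induction f rule: mpoly_induct)
  case (const c)
  show ?case by (simp add: swap_vars_const)
next
  case (var j)
  have "X i - X (i + 1) dvd X (i + 1) - X i" by (metis dvd_refl dvd_minus_iff minus_diff_eq)
  then show ?case by (simp add: swap_vars_X Transposition.transpose_def)
next
  case (add f g)
  have "f + g - swap_vars i (f + g) = (f - swap_vars i f) + (g - swap_vars i g)"
    by (simp add: swap_vars_add)
  with add show ?case by (simp only: dvd_add)
next
  case (mult f g)
  have "f * g - swap_vars i (f * g) =
      (f - swap_vars i f) * g + swap_vars i f * (g - swap_vars i g)"
    by (simp add: swap_vars_mult algebra_simps)
  with mult show ?case by (simp only: dvd_add dvd_mult dvd_mult2)
qed

lemma divided_difference_unique:
  assumes "(X i - X (i + 1)) * g = f - swap_vars i f"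
  shows "divided_difference i f = g"
  unfolding divided_difference_def
proof (rule the_equality)
  fix h assume "(X i - X (i + 1)) * h = f - swap_vars i f"
  with assms have "(X i - X (i + 1)) * h = (X i - X (i + 1)) * g" by simp
  moreover have "X i - X (i + 1) \<noteq> 0" by simp
  ultimately show "h = g" by (metis mult_left_cancel)
qed (fact assms)

lemma divided_difference_eq:
  "(X i - X (i + 1)) * divided_difference i f = f - swap_vars i f"
proof -
  obtain g where "f - swap_vars i f = (X i - X (i + 1)) * g"
    using diff_swap_vars_dvd[of i f] by (rule dvdE)
  then show ?thesis using divided_difference_unique[of i g f] by simp
qed

abbreviation isobaric :: "nat \<Rightarrow> mpoly \<Rightarrow> mpoly"
  where "isobaric i f \<equiv> divided_difference i ((1 - X (i + 1)) * f)"

lemma isobaric_eq: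
  "(X i - X (i + 1)) * isobaric i f = (1 - X (i + 1)) * f - (1 - X i) * swap_vars i f"
  by (simp only: divided_difference_eq swap_vars_hom swap_vars_1 transpose_apply_second)

lemma isobaric_commute:
  assumes "i + 1 < j"
  shows "isobaric i (isobaric j f) = isobaric j (isobaric i f)"
proof -
  define a b c d where abcd: "a = X i" "b = X (i + 1)" "c = X j" "d = X (j + 1)"
  have ne: "(a - b) * (c - d) \<noteq> 0" by (simp add: abcd)
  have sw: "swap_vars i c = c" "swap_vars i d = d" "swap_vars j a = a" "swap_vars j b = b"
    using assms by (simp_all add: abcd swap_vars_X Transposition.transpose_def)
  have ei: "(a - b) * isobaric i g = (1 - b) * g - (1 - a) * swap_vars i g" for g
    using isobaric_eq[of i g] by (simp only: abcd)
  have ej: "(c - d) * isobaric j g = (1 - d) * g - (1 - c) * swap_vars j g" for g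
    using isobaric_eq[of j g] by (simp only: abcd)
  have sij: "(c - d) * swap_vars i (isobaric j f) =
      (1 - d) * swap_vars i f - (1 - c) * swap_vars i (swap_vars j f)"
    using arg_cong[OF ej[of f], of "swap_vars i"]
    by (simp only: swap_vars_diff swap_vars_mult swap_vars_1 sw)
  have sji: "(a - b) * swap_vars j (isobaric i f) =
      (1 - b) * swap_vars j f - (1 - a) * swap_vars i (swap_vars j f)"
    using arg_cong[OF ei[of f], of "swap_vars j"]
    by (simp only: swap_vars_diff swap_vars_mult swap_vars_1 sw swap_vars_commute[OF assms])
  have "(a - b) * (c - d) * isobaric i (isobaric j f) =
      (c - d) * ((a - b) * isobaric i (isobaric j f))" by (simp add: ac_simps)
  also have "\<dots> = (1 - b) * ((c - d) * isobaric j f) -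
      (1 - a) * ((c - d) * swap_vars i (isobaric j f))"
    by (subst ei) (simp add: algebra_simps)
  also have "\<dots> = (1 - d) * ((a - b) * isobaric i f) -
      (1 - c) * ((a - b) * swap_vars j (isobaric i f))"
    by (simp only: ei ej sij sji) (simp add: algebra_simps)
  also have "\<dots> = (a - b) * ((c - d) * isobaric j (isobaric i f))"
    by (subst ej) (simp add: algebra_simps)
  also have "\<dots> = (a - b) * (c - d) * isobaric j (isobaric i f)" by (simp add: ac_simps)
  finally show ?thesis using ne by (metis mult_left_cancel)
qed

lemma isobaric_braid:
  "isobaric i (isobaric (i + 1) (isobaric i f)) =
    isobaric (i + 1) (isobaric i (isobaric (i + 1) f))"
proof -
  define a b c where abc: "a = X i" "b = X (i + 1)" "c = X (i + 2)"
  define s t where st: "s = swap_vars i" "t = swap_vars (i + 1)"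
  define S T where ST: "S = isobaric i" "T = isobaric (i + 1)"
  have ne: "a - b \<noteq> 0" "a - c \<noteq> 0" "b - c \<noteq> 0" by (simp_all add: abc)
  have hom: "s (g * h) = s g * s h" "s (g - h) = s g - s h" "s 1 = 1" "s (s g) = g"
    "t (g * h) = t g * t h" "t (g - h) = t g - t h" "t 1 = 1" "t (t g) = g" for g h
    by (simp_all add: st swap_vars_hom swap_vars_involutory)
  have var: "s a = b" "s b = a" "s c = c" "t a = a" "t b = c" "t c = b"
    by (simp_all add: abc st swap_vars_X Transposition.transpose_def)
  have braid: "t (s (t f)) = s (t (s f))"
    using swap_vars_braid by (simp add: st)
  have S: "(a - b) * S g = (1 - b) * g - (1 - a) * s g" for g
    using isobaric_eq[of i g] by (simp only: abc st ST)
  have T: "(b - c) * T g = (1 - c) * g - (1 - b) * t g" for g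
    using isobaric_eq[of "i + 1" g] by (simp add: abc st ST)
  define N where "N = (1 - b) * (1 - c)^2 * f - (1 - a) * (1 - c)^2 * s f
    - (1 - c) * (1 - b)^2 * t f + (1 - c) * (1 - a)^2 * s (t f)
    + (1 - a) * (1 - b)^2 * t (s f) - (1 - b) * (1 - a)^2 * s (t (s f))"
  define V where "V = (a - b) * (a - c) * (b - c)"
  have V: "V \<noteq> 0" using ne by (simp add: V_def)
  have "V * S (T (S f)) = N"
  proof -
    define v where "v = T (S f)"
    have tu: "(a - c) * t (S f) = (1 - c) * t f - (1 - a) * t (s f)"
      using arg_cong[OF S[of f], of t] by (simp only: hom var)
    have "V * v = (a - b) * (a - c) * ((b - c) * v)" by (simp add: V_def ac_simps)
    also have "\<dots> = (a - c) * (1 - c) * ((a - b) * S f) -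
        (1 - b) * (a - b) * ((a - c) * t (S f))"
      unfolding v_def T by (simp add: algebra_simps)
    finally have v: "V * v = (a - c) * (1 - c) * ((1 - b) * f - (1 - a) * s f) -
        (1 - b) * (a - b) * ((1 - c) * t f - (1 - a) * t (s f))"
      by (simp only: S tu)
    have sv: "(b - a) * (b - c) * (a - c) * s v =
        (b - c) * (1 - c) * ((1 - a) * s f - (1 - b) * f) -
        (1 - a) * (b - a) * ((1 - c) * s (t f) - (1 - b) * s (t (s f)))"
      using arg_cong[OF v, of s] by (simp only: V_def hom var)
    have "(a - b) * (V * S v) = V * ((a - b) * S v)" by (simp add: ac_simps)
    also have "\<dots> = (1 - b) * (V * v) +
        (1 - a) * ((b - a) * (b - c) * (a - c) * s v)"
      unfolding S by (simp add: V_def algebra_simps)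
    also have "\<dots> = (a - b) * N"
      unfolding v sv by (simp add: N_def algebra_simps power2_eq_square)
    finally show ?thesis unfolding v_def using ne by (metis mult_left_cancel)
  qed
  moreover have "V * T (S (T f)) = N"
  proof -
    define v where "v = S (T f)"
    have su: "(a - c) * s (T f) = (1 - c) * s f - (1 - a) * s (t f)"
      using arg_cong[OF T[of f], of s] by (simp only: hom var)
    have "V * v = (b - c) * (a - c) * ((a - b) * v)" by (simp add: V_def ac_simps)
    also have "\<dots> = (a - c) * (1 - b) * ((b - c) * T f) -
        (b - c) * (1 - a) * ((a - c) * s (T f))"
      unfolding v_def S by (simp add: algebra_simps)
    finally have v: "V * v = (a - c) * (1 - b) * ((1 - c) * f - (1 - b) * t f) -
        (b - c) * (1 - a) * ((1 - c) * s f - (1 - a) * s (t f))"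
      by (simp only: T su)
    have tv: "(a - c) * (a - b) * (c - b) * t v =
        (a - b) * (1 - c) * ((1 - b) * t f - (1 - c) * f) -
        (c - b) * (1 - a) * ((1 - b) * t (s f) - (1 - a) * s (t (s f)))"
      using arg_cong[OF v, of t] by (simp only: V_def hom var braid)
    have "(b - c) * (V * T v) = V * ((b - c) * T v)" by (simp add: ac_simps)
    also have "\<dots> = (1 - c) * (V * v) +
        (1 - b) * ((a - c) * (a - b) * (c - b) * t v)"
      unfolding T by (simp add: V_def algebra_simps)
    also have "\<dots> = (b - c) * N"
      unfolding v tv by (simp add: N_def algebra_simps power2_eq_square)
    finally show ?thesis unfolding v_def using ne by (metis mult_left_cancel)
  qed
  ultimately have "S (T (S f)) = T (S (T f))" using V by (metis mult_left_cancel)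
  then show ?thesis by (simp only: ST)
qed

lemma longest_perm_permutes: "longest_perm n permutes {1..n}"
proof (rule bij_imp_permutes)
  show "bij_betw (longest_perm n) {1..n} {1..n}"
    by (rule bij_betw_byWitness[where f' = "longest_perm n"]) (auto simp: longest_perm_def)
qed (auto simp: longest_perm_def)

lemma permutes_swap:
  fixes i n :: nat
  assumes "w permutes {1..n}" "1 \<le> i" "i < n"
  shows "w \<circ> Transposition.transpose i (i + 1) permutes {1..n}"
  by (rule permutes_compose[OF permutes_swap_id assms(1)]) (use assms(2,3) in auto)

lemma exists_ascent:
  assumes w: "w permutes {1..n}" and ne: "w \<noteq> longest_perm n"
  obtains i where "1 \<le> i" "i < n" "w i < w (i + 1)"
proof -
  have "\<exists>i. 1 \<le> i \<and> i < n \<and> w i < w (i + 1)"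
  proof (rule ccontr)
    assume none: "\<not> ?thesis"
    have desc: "w (i + 1) < w i" if "1 \<le> i" "i < n" for i
    proof -
      have "w i \<noteq> w (i + 1)" using permutes_inj[OF w] by (metis injD less_add_one less_irrefl)
      with none that show ?thesis by (metis linorder_neqE_nat)
    qed
    have range: "1 \<le> w i \<and> w i \<le> n" if "1 \<le> i" "i \<le> n" for i
      using permutes_in_image[OF w, of i] that by simp
    have upper: "Suc k \<le> n \<longrightarrow> w (Suc k) + Suc k \<le> n + 1" for k
    proof (induction k)
      case 0
      show ?case using range[of 1] by auto
    next
      case (Suc k)
      then show ?case using desc[of "Suc k"] by auto
    qed
    have lower: "k < n \<longrightarrow> k + 1 \<le> w (n - k)" for k
    proof (induction k)
      case 0
      show ?case using range[of n] by auto
    next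
      case (Suc k)
      have "n - Suc k + 1 = n - k" if "Suc k < n" using that by simp
      moreover have "w (n - Suc k + 1) < w (n - Suc k)" if "Suc k < n"
        by (rule desc) (use that in auto)
      ultimately show ?case using Suc by auto
    qed
    have "w i = longest_perm n i" for i
    proof (cases "i \<in> {1..n}")
      case True
      then obtain k where k: "i = Suc k" "k < n" by (cases i) auto
      have "n - i + 1 \<le> w i" using lower[of "n - i"] True by auto
      moreover have "w i + i \<le> n + 1" using upper[of k] k by auto
      ultimately show ?thesis using True by (auto simp: longest_perm_def)
    next
      case False
      then show ?thesis using permutes_not_in[OF w] by (auto simp: longest_perm_def)
    qed
    with ne show False by auto
  qed
  with that show ?thesis by blast
qed

definition noninversions :: "nat \<Rightarrow> (nat \<Rightarrow> nat) \<Rightarrow> (nat \<times> nat) set"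
  where "noninversions n w = {(p, q). 1 \<le> p \<and> p < q \<and> q \<le> n \<and> w p < w q}"

lemma card_noninversions_less:
  assumes "1 \<le> i" "i < n" "w i < w (i + 1)"
  shows "card (noninversions n (w \<circ> Transposition.transpose i (i + 1))) <
    card (noninversions n w)"
proof -
  let ?t = "Transposition.transpose i (i + 1)"
  let ?A = "noninversions n (w \<circ> ?t)" and ?B = "noninversions n w"
  have fin: "finite ?B"
    by (rule finite_subset[of _ "{1..n} \<times> {1..n}"]) (auto simp: noninversions_def)
  have inj: "inj_on (map_prod ?t ?t) ?A"
    by (rule inj_onI) (auto simp: transpose_eq_iff)
  have sub: "map_prod ?t ?t ` ?A \<subseteq> ?B - {(i, i + 1)}"
  proof (rule image_subsetI)
    fix x assume "x \<in> ?A"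
    then obtain p q where x: "x = (p, q)" and
      pq: "1 \<le> p" "p < q" "q \<le> n" "w (?t p) < w (?t q)"
      by (auto simp: noninversions_def)
    have "\<not> (p = i \<and> q = i + 1)" using pq(4) assms(3) by auto
    then show "map_prod ?t ?t x \<in> ?B - {(i, i + 1)}"
      using pq assms(1,2) unfolding x
      by (auto simp: noninversions_def Transposition.transpose_def split: if_splits)
  qed
  have "card ?A = card (map_prod ?t ?t ` ?A)" by (rule card_image[OF inj, symmetric])
  also have "\<dots> \<le> card (?B - {(i, i + 1)})" by (rule card_mono) (use fin sub in auto)
  also have "\<dots> < card ?B"
    by (rule card_Diff1_less) (use fin assms in \<open>auto simp: noninversions_def\<close>)
  finally show ?thesis .
qed

lemma is_grothendieck_exists:
  assumes "w permutes {1..n}"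
  shows "\<exists>g. is_grothendieck n w g"
  using assms
proof (induction "card (noninversions n w)" arbitrary: w rule: less_induct)
  case less
  show ?case
  proof (cases "w = longest_perm n")
    case True
    then show ?thesis using is_grothendieck.longest by blast
  next
    case False
    with less.prems obtain i where i: "1 \<le> i" "i < n" "w i < w (i + 1)"
      by (rule exists_ascent)
    obtain g where "is_grothendieck n (w \<circ> Transposition.transpose i (i + 1)) g"
      using less.hyps[OF card_noninversions_less permutes_swap] i less.prems by blast
    with less.prems i show ?thesis by (blast intro: is_grothendieck.ascent)
  qed
qed

lemma isobaric_confluent:
  assumes w: "w permutes {1..n}"
    and unique: "\<And>k g h. 1 \<le> k \<Longrightarrow> k < n \<Longrightarrow> w k < w (k + 1) \<Longrightarrow>
      is_grothendieck n (w \<circ> Transposition.transpose k (k + 1)) g \<Longrightarrow>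
      is_grothendieck n (w \<circ> Transposition.transpose k (k + 1)) h \<Longrightarrow> g = h"
    and i: "1 \<le> i" "i < n" "w i < w (i + 1)"
      "is_grothendieck n (w \<circ> Transposition.transpose i (i + 1)) g"
    and j: "1 \<le> j" "j < n" "w j < w (j + 1)"
      "is_grothendieck n (w \<circ> Transposition.transpose j (j + 1)) h"
    and less: "i < j"
  shows "isobaric i g = isobaric j h"
proof (cases "j = i + 1")
  case False
  with less have ij: "i + 1 < j" by simp
  let ?s = "Transposition.transpose i (i + 1)" and ?t = "Transposition.transpose j (j + 1)"
  have comm: "w \<circ> ?s \<circ> ?t = w \<circ> ?t \<circ> ?s"
    using ij by (auto simp: fun_eq_iff Transposition.transpose_def)
  have ps: "w \<circ> ?s permutes {1..n}" and pt: "w \<circ> ?t permutes {1..n}"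
    using permutes_swap[OF w] i j by blast+
  obtain f where f: "is_grothendieck n (w \<circ> ?s \<circ> ?t) f"
    using is_grothendieck_exists[OF permutes_swap[OF ps j(1,2)]] by blast
  have "is_grothendieck n (w \<circ> ?s) (isobaric j f)"
    by (rule is_grothendieck.ascent[OF ps j(1,2) _ f])
      (use ij j(3) in \<open>simp add: Transposition.transpose_def\<close>)
  then have g: "g = isobaric j f" using unique i by blast
  have "is_grothendieck n (w \<circ> ?t) (isobaric i f)"
    by (rule is_grothendieck.ascent[OF pt i(1,2) _ f[unfolded comm]])
      (use ij i(3) in \<open>simp add: Transposition.transpose_def\<close>)
  then have h: "h = isobaric i f" using unique j by blast
  show ?thesis unfolding g h by (rule isobaric_commute[OF ij])
next
  case True
  let ?s = "Transposition.transpose i (i + 1)" and ?t = "Transposition.transpose j (j + 1)"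
  have braid: "w \<circ> ?s \<circ> ?t \<circ> ?s = w \<circ> ?t \<circ> ?s \<circ> ?t"
    unfolding True by (auto simp: fun_eq_iff Transposition.transpose_def)
  have ps: "w \<circ> ?s permutes {1..n}" and pt: "w \<circ> ?t permutes {1..n}"
    using permutes_swap[OF w] i j by blast+
  have pst: "w \<circ> ?s \<circ> ?t permutes {1..n}" and pts: "w \<circ> ?t \<circ> ?s permutes {1..n}"
    using permutes_swap[OF ps j(1,2)] permutes_swap[OF pt i(1,2)] by blast+
  obtain f where f: "is_grothendieck n (w \<circ> ?s \<circ> ?t \<circ> ?s) f"
    using is_grothendieck_exists[OF permutes_swap[OF pst i(1,2)]] by blast
  have "is_grothendieck n (w \<circ> ?s \<circ> ?t) (isobaric i f)"
    by (rule is_grothendieck.ascent[OF pst i(1,2) _ f])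
      (use True i(3) j(3) in \<open>simp add: Transposition.transpose_def\<close>)
  then have "is_grothendieck n (w \<circ> ?s) (isobaric j (isobaric i f))"
    by (rule is_grothendieck.ascent[OF ps j(1,2), rotated])
      (use True i(3) j(3) in \<open>simp add: Transposition.transpose_def\<close>)
  then have g: "g = isobaric j (isobaric i f)" using unique i by blast
  have "is_grothendieck n (w \<circ> ?t \<circ> ?s) (isobaric j f)"
    by (rule is_grothendieck.ascent[OF pts j(1,2) _ f[unfolded braid]])
      (use True i(3) j(3) in \<open>simp add: Transposition.transpose_def\<close>)
  then have "is_grothendieck n (w \<circ> ?t) (isobaric i (isobaric j f))"
    by (rule is_grothendieck.ascent[OF pt i(1,2), rotated])
      (use True i(3) j(3) in \<open>simp add: Transposition.transpose_def\<close>)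
  then have h: "h = isobaric i (isobaric j f)" using unique j by blast
  show ?thesis unfolding g h True by (rule isobaric_braid)
qed

lemma is_grothendieck_unique:
  assumes "w permutes {1..n}" "is_grothendieck n w g" "is_grothendieck n w h"
  shows "g = h"
  using assms
proof (induction "card (noninversions n w)" arbitrary: w g h rule: less_induct)
  case less
  have unique: "g = h" if "1 \<le> k" "k < n" "w k < w (k + 1)"
    "is_grothendieck n (w \<circ> Transposition.transpose k (k + 1)) g"
    "is_grothendieck n (w \<circ> Transposition.transpose k (k + 1)) h" for k g h
    using less.hyps[OF card_noninversions_less permutes_swap] that less.prems(1) by blast
  show ?case
  proof (cases "w = longest_perm n")
    case True
    have none: "\<not> w k < w (k + 1)" if "1 \<le> k" "k < n" for k
      using that by (auto simp: True longest_perm_def)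
    have "x = (\<Prod>i\<in>{1..<n}. X i ^ (n - i))" if "is_grothendieck n w x" for x
      using that
    proof cases
      case longest
      show ?thesis by (fact longest)
    next
      case (ascent k x')
      with none show ?thesis by blast
    qed
    from this[OF less.prems(2)] this[OF less.prems(3)] show ?thesis by simp
  next
    case False
    have inversion: "\<exists>k x'. 1 \<le> k \<and> k < n \<and> w k < w (k + 1) \<and>
        is_grothendieck n (w \<circ> Transposition.transpose k (k + 1)) x' \<and> x = isobaric k x'"
      if "is_grothendieck n w x" for x
      using that
    proof cases
      case longest
      with False show ?thesis by simp
    next
      case (ascent k x')
      show ?thesis by (intro exI conjI) (fact ascent)+
    qed
    obtain i g' where i: "1 \<le> i" "i < n" "w i < w (i + 1)"
      "is_grothendieck n (w \<circ> Transposition.transpose i (i + 1)) g'" "g = isobaric i g'"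
      using inversion[OF less.prems(2)] by (elim exE conjE)
    obtain j h' where j: "1 \<le> j" "j < n" "w j < w (j + 1)"
      "is_grothendieck n (w \<circ> Transposition.transpose j (j + 1)) h'" "h = isobaric j h'"
      using inversion[OF less.prems(3)] by (elim exE conjE)
    consider "i = j" | "i < j" | "j < i" by linarith
    then show ?thesis
    proof cases
      case 1
      with i j show ?thesis using unique by metis
    next
      case 2
      show ?thesis unfolding i(5) j(5)
        by (rule isobaric_confluent[OF less.prems(1) unique i(1-4) j(1-4) 2])
    next
      case 3
      show ?thesis unfolding i(5) j(5)
        by (rule isobaric_confluent[OF less.prems(1) unique j(1-4) i(1-4) 3, symmetric])
    qed
  qed
qed

lemma ex1_is_grothendieck:
  assumes "w permutes {1..n}"
  shows "\<exists>!g. is_grothendieck n w g"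
  using is_grothendieck_exists[OF assms] is_grothendieck_unique[OF assms] by blast

lemma grothendieck_eqI:
  assumes "w permutes {1..n}" "is_grothendieck n w g"
  shows "grothendieck n w = g"
  unfolding grothendieck_def using ex1_is_grothendieck[OF assms(1)] assms(2)
  by (rule the1_equality)

lemma is_grothendieck_grothendieck:
  assumes "w permutes {1..n}"
  shows "is_grothendieck n w (grothendieck n w)"
  unfolding grothendieck_def by (rule theI'[OF ex1_is_grothendieck[OF assms]])

theorem grothendieck_longest:
  "grothendieck n (longest_perm n) = (\<Prod>i\<in>{1..<n}. X i ^ (n - i))"
  by (rule grothendieck_eqI[OF longest_perm_permutes is_grothendieck.longest])

theorem grothendieck_ascent:
  assumes "w permutes {1..n}" "1 \<le> i" "i < n" "w i < w (i + 1)"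
  shows "grothendieck n w = divided_difference i
    ((1 - X (i + 1)) * grothendieck n (w \<circ> Transposition.transpose i (i + 1)))"
  by (rule grothendieck_eqI[OF assms(1) is_grothendieck.ascent[OF assms]])
    (rule is_grothendieck_grothendieck[OF permutes_swap[OF assms(1-3)]])

end

theory Submission
  imports Defs
begin

text \<open>
  Let $c_k$ be the number of later values smaller than $w(k)$, let $U_j$ be the number of values
  among $w(j), \ldots, w(n)$ that are not left-to-right maxima of that sequence, and let $q_k$ be
  the number of values larger than $w(k)$ that are not left-to-right maxima of
  $w(k+1), \ldots, w(n)$.  The three patterns are avoided iff $q_k \le 1$ for all $k$.

  The exponent of $x_j$ in a monomial of $\mathfrak{G}_w$ lies between $\min_{k \le j} c_k$ and
  $U_j \le \min_{k \le j} (c_k + q_k)$, so if $w$ avoids the patterns, the support is contained in a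
  translate of the unit cube, and all lattice points of the polytope are vertices.

  Conversely, let $k$ be maximal with $q_k \ge 2$.  Then $w(k) < w(k+1)$, so $\mathfrak{G}_w$ is
  symmetric in $x_k$ and $x_{k+1}$, and $U_{k+1} \ge c_k + 2$.  Some monomial has exponent $c_k$ at
  $x_k$ and $U_{k+1}$ at $x_{k+1}$; the segment from it to its image under the symmetry has a
  lattice point in its interior.  This monomial is found in the lowest-degree part, the Schubert
  polynomial: deleting the first rows is extracting the minimal powers of their variables, and
  extracting the maximal power of the next variable again gives a nonzero Schubert polynomial.
\<close>

section \<open>Coefficients of divided differences\<close>

text \<open>The obstacle is cancellation, caused by the factors 1 - x_{i+1} and by the signs in the
  divided differences. Bounds on the support are immune to it: every monomial of G_w, the
  Grothendieck polynomial of w, comes from some monomial of the one of w s_i, and exponents can be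
  tracked backwards. Nonvanishing is not immune, and no positivity result is invoked for it. It
  comes from identities between single coefficients: where a divided difference touches the extremal
  exponent, the support bounds kill all its terms but one, and elsewhere it acts alike on both sides
  of the identity. The chain of identities ends at the coefficient 1 of the monomial of the longest
  permutation. Working in lowest degree makes this possible, since the factor 1 - x_{i+1} acts there
  as 1.

  The choice of ascent matters too. A swap at an ascent i > j preserves U_j only if w(i) is not a
  left-to-right maximum of w(j), ..., w(n). Recursing along the first ascent guarantees this,
  because w decreases up to i.\<close>

definition coeff_at :: "mpoly \<Rightarrow> (nat \<Rightarrow> nat) \<Rightarrow> int"
  where "coeff_at f \<beta> =
    (if finite {k. \<beta> k \<noteq> 0} then Poly_Mapping.lookup f (Abs_poly_mapping \<beta>) else 0)"

lemma coeff_at_lookup: "coeff_at f (Poly_Mapping.lookup \<alpha>) = Poly_Mapping.lookup f \<alpha>"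
  by (simp add: coeff_at_def lookup_inverse)

text \<open>Exponent vectors are plain functions here, so that function update and composition with
  a transposition apply directly. The value 0 at infinite support frees the coefficient identities
  from finiteness hypotheses; a nonzero coefficient gives the finiteness back.\<close>

lemma coeff_at_nonzeroE:
  assumes "coeff_at f \<beta> \<noteq> 0"
  obtains \<alpha> where "\<beta> = Poly_Mapping.lookup \<alpha>" "\<alpha> \<in> Poly_Mapping.keys f"
proof
  have fin: "finite {k. \<beta> k \<noteq> 0}" using assms by (metis coeff_at_def)
  then show "\<beta> = Poly_Mapping.lookup (Abs_poly_mapping \<beta>)"
    by (simp add: Abs_poly_mapping_inverse)
  show "Abs_poly_mapping \<beta> \<in> Poly_Mapping.keys f"
    using assms fin by (simp add: coeff_at_def in_keys_iff)
qed

lemma finite_support_update: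
  "finite {k. (\<beta>(i := x)) k \<noteq> (0::nat)} \<longleftrightarrow> finite {k. \<beta> k \<noteq> 0}"
proof -
  have "{k. (\<beta>(i := x)) k \<noteq> 0} \<subseteq> insert i {k. \<beta> k \<noteq> 0}"
    "{k. \<beta> k \<noteq> 0} \<subseteq> insert i {k. (\<beta>(i := x)) k \<noteq> 0}" by auto
  then show ?thesis by (meson finite.insertI finite_subset)
qed

lemma coeff_at_diff: "coeff_at (f - g) \<beta> = coeff_at f \<beta> - coeff_at g \<beta>"
  by (simp add: coeff_at_def lookup_minus)

lemma lookup_single_times:
  fixes g :: "('a::cancel_comm_monoid_add) \<Rightarrow>\<^sub>0 int"
  shows "Poly_Mapping.lookup (Poly_Mapping.single \<alpha> 1 * g) (\<alpha> + \<beta>) = Poly_Mapping.lookup g \<beta>"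
proof (induction g rule: poly_mapping_decomp_induct)
  case (2 k c)
  show ?case by (auto simp: mult_single lookup_single when_def)
qed (simp_all add: distrib_left lookup_add)

lemma lookup_single_times_0:
  fixes g :: "('a::cancel_comm_monoid_add) \<Rightarrow>\<^sub>0 int"
  assumes "\<And>\<beta>. \<gamma> \<noteq> \<alpha> + \<beta>"
  shows "Poly_Mapping.lookup (Poly_Mapping.single \<alpha> 1 * g) \<gamma> = 0"
proof (induction g rule: poly_mapping_decomp_induct)
  case (2 k c)
  show ?case using assms[of k] by (auto simp: mult_single lookup_single when_def)
qed (simp_all add: distrib_left lookup_add)

lemma coeff_at_X_times:
  "coeff_at (X i * g) \<beta> = (if \<beta> i = 0 then 0 else coeff_at g (\<beta>(i := \<beta> i - 1)))"
proof (cases "finite {k. \<beta> k \<noteq> 0}")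
  case False
  then show ?thesis
    by (simp add: coeff_at_def finite_support_update del: fun_upd_apply neq0_conv)
next
  case True
  define \<alpha> where "\<alpha> = Abs_poly_mapping \<beta>"
  have \<beta>: "\<beta> = Poly_Mapping.lookup \<alpha>"
    using True by (simp add: \<alpha>_def Abs_poly_mapping_inverse)
  show ?thesis
  proof (cases "\<beta> i = 0")
    case True
    have "\<alpha> \<noteq> Poly_Mapping.single i 1 + \<gamma>" for \<gamma>
      using True by (auto simp: \<beta> lookup_add)
    with True show ?thesis by (simp add: \<beta> coeff_at_lookup X_def lookup_single_times_0)
  next
    case False
    define \<gamma> where "\<gamma> = Abs_poly_mapping (\<beta>(i := \<beta> i - 1))"
    have \<gamma>: "\<beta>(i := \<beta> i - 1) = Poly_Mapping.lookup \<gamma>"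
      using True by (simp add: \<gamma>_def Abs_poly_mapping_inverse finite_support_update
          del: fun_upd_apply neq0_conv)
    have "\<alpha> = Poly_Mapping.single i 1 + \<gamma>"
      by (rule poly_mapping_eqI)
        (use False in \<open>auto simp: lookup_add lookup_single when_def \<beta>[symmetric] \<gamma>[symmetric]\<close>)
    then have "coeff_at (X i * g) \<beta> = Poly_Mapping.lookup g \<gamma>"
      by (simp only: \<beta> coeff_at_lookup X_def lookup_single_times)
    also have "\<dots> = coeff_at g (\<beta>(i := \<beta> i - 1))" by (simp only: \<gamma> coeff_at_lookup)
    finally show ?thesis using False by simp
  qed
qed

lemma coeff_at_swap_vars:
  "coeff_at (swap_vars i f) \<beta> = coeff_at f (\<beta> \<circ> Transposition.transpose i (i + 1))"
proof -
  let ?t = "Transposition.transpose i (i + 1)"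
  have "{k. (\<beta> \<circ> ?t) k \<noteq> 0} = ?t ` {k. \<beta> k \<noteq> 0}"
    by (auto simp: image_iff) (metis transpose_involutory)
  then have fin: "finite {k. (\<beta> \<circ> ?t) k \<noteq> 0} \<longleftrightarrow> finite {k. \<beta> k \<noteq> 0}"
    by (simp only: finite_image_iff[OF inj_on_transpose])
  show ?thesis
  proof (cases "finite {k. \<beta> k \<noteq> 0}")
    case False
    with fin show ?thesis by (simp add: coeff_at_def del: o_apply)
  next
    case True
    define \<alpha> where "\<alpha> = Abs_poly_mapping \<beta>"
    have \<beta>: "\<beta> = Poly_Mapping.lookup \<alpha>"
      using True by (simp add: \<alpha>_def Abs_poly_mapping_inverse)
    have "\<beta> \<circ> ?t = Poly_Mapping.lookup (Poly_Mapping.map_key ?t \<alpha>)"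
      by (simp add: \<beta> map_key.rep_eq)
    then have "coeff_at f (\<beta> \<circ> ?t) = Poly_Mapping.lookup f (Poly_Mapping.map_key ?t \<alpha>)"
      by (simp only: coeff_at_lookup)
    then show ?thesis
      by (simp add: \<beta> coeff_at_lookup swap_vars_def map_key.rep_eq inj_map_key_transpose)
  qed
qed

text \<open>
  The coefficients of $\partial_i f$, obtained by telescoping the coefficient equations of
  $(x_i - x_{i+1}) \, \partial_i f = f - s_i f$ along the monomials $x_i^a x_{i+1}^b$ of a fixed degree.
\<close>

definition dd :: "nat \<Rightarrow> ((nat \<Rightarrow> nat) \<Rightarrow> int) \<Rightarrow> (nat \<Rightarrow> nat) \<Rightarrow> int"
  where "dd i F \<beta> = (\<Sum>t\<le>\<beta> i. F (\<beta>(i := \<beta> i + \<beta> (i + 1) + 1 - t, i + 1 := t)) -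
    F (\<beta>(i := t, i + 1 := \<beta> i + \<beta> (i + 1) + 1 - t)))"

lemma coeff_at_divided_difference:
  "coeff_at (divided_difference i f) \<beta> = dd i (coeff_at f) \<beta>"
proof (induction "\<beta> i" arbitrary: \<beta>)
  case 0
  let ?g = "divided_difference i f" and ?\<gamma> = "\<beta>(i + 1 := \<beta> (i + 1) + 1)"
  have "coeff_at (X i * ?g) ?\<gamma> - coeff_at (X (i + 1) * ?g) ?\<gamma> =
      coeff_at f ?\<gamma> - coeff_at f (?\<gamma> \<circ> Transposition.transpose i (i + 1))"
    using arg_cong[OF divided_difference_eq[of i f], of "\<lambda>h. coeff_at h ?\<gamma>"]
    by (simp only: left_diff_distrib coeff_at_diff coeff_at_swap_vars)
  moreover have "?\<gamma> \<circ> Transposition.transpose i (i + 1) =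
      \<beta>(i := \<beta> (i + 1) + 1, i + 1 := \<beta> i)"
    by (auto simp: fun_eq_iff Transposition.transpose_def)
  moreover have "\<beta>(i := 0, i + 1 := x) = \<beta>(i + 1 := x)" for x using 0 by auto
  ultimately show ?case using 0 by (simp add: coeff_at_X_times dd_def)
next
  case (Suc p)
  \<comment> \<open>Removing one x_{i+1} from \<open>?\<gamma>\<close> gives \<beta>, removing one
    x_i gives its neighbour \<open>?\<beta>\<close> of the same degree. The coefficient equation at
    \<open>?\<gamma>\<close> therefore adds exactly the summand t = \<beta> i.\<close>
  let ?g = "divided_difference i f" and ?\<gamma> = "\<beta>(i + 1 := \<beta> (i + 1) + 1)"
  let ?\<beta> = "\<beta>(i := p, i + 1 := \<beta> (i + 1) + 1)"
  have "coeff_at (X i * ?g) ?\<gamma> - coeff_at (X (i + 1) * ?g) ?\<gamma> =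
      coeff_at f ?\<gamma> - coeff_at f (?\<gamma> \<circ> Transposition.transpose i (i + 1))"
    using arg_cong[OF divided_difference_eq[of i f], of "\<lambda>h. coeff_at h ?\<gamma>"]
    by (simp only: left_diff_distrib coeff_at_diff coeff_at_swap_vars)
  moreover have "?\<gamma> \<circ> Transposition.transpose i (i + 1) =
      \<beta>(i := \<beta> (i + 1) + 1, i + 1 := \<beta> i)"
    by (auto simp: fun_eq_iff Transposition.transpose_def)
  moreover have "coeff_at (X i * ?g) ?\<gamma> = coeff_at ?g ?\<beta>"
    by (simp add: coeff_at_X_times fun_upd_twist flip: Suc(2))
  moreover have "coeff_at (X (i + 1) * ?g) ?\<gamma> = coeff_at ?g \<beta>"
    by (simp add: coeff_at_X_times)
  moreover have "coeff_at ?g ?\<beta> = dd i (coeff_at f) ?\<beta>" by (rule Suc(1)) simp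
  moreover have "\<beta>(i := Suc p, i + 1 := x) = \<beta>(i + 1 := x)" for x using Suc(2) by auto
  ultimately show ?case
    using Suc(2)[symmetric] by (simp add: dd_def fun_upd_twist[of "Suc i" i])
qed

lemma swap_vars_divided_difference: "swap_vars i (divided_difference i f) = divided_difference i f"
proof -
  have "(X (i + 1) - X i) * swap_vars i (divided_difference i f) = swap_vars i f - f"
    using arg_cong[OF divided_difference_eq[of i f], of "swap_vars i"]
    by (simp add: swap_vars_hom swap_vars_involutory)
  then have "(X i - X (i + 1)) * swap_vars i (divided_difference i f) = f - swap_vars i f"
    by (simp add: algebra_simps)
  then show ?thesis by (rule divided_difference_unique[symmetric])
qed

lemma coeff_at_divided_difference_swap:
  "coeff_at (divided_difference i f) (\<beta> \<circ> Transposition.transpose i (i + 1)) =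
    coeff_at (divided_difference i f) \<beta>"
  by (metis coeff_at_swap_vars swap_vars_divided_difference)

lemma dd_nonzeroE:
  assumes "dd i F \<beta> \<noteq> 0"
  obtains t where "t \<le> \<beta> i"
    "F (\<beta>(i := \<beta> i + \<beta> (i + 1) + 1 - t, i + 1 := t)) \<noteq> 0 \<or>
     F (\<beta>(i := t, i + 1 := \<beta> i + \<beta> (i + 1) + 1 - t)) \<noteq> 0"
proof -
  from assms obtain t where "t \<in> {..\<beta> i}" "F (\<beta>(i := \<beta> i + \<beta> (i + 1) + 1 - t, i + 1 := t)) -
    F (\<beta>(i := t, i + 1 := \<beta> i + \<beta> (i + 1) + 1 - t)) \<noteq> 0"
    unfolding dd_def by (rule sum.not_neutral_contains_not_neutral)
  then show thesis by (intro that[of t]) auto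
qed

text \<open>A divided difference is symmetric in x_i and x_{i+1}, so the sum in \<open>dd\<close>
  may be truncated at the exponent of either variable; a records the choice.\<close>

lemma divided_difference_nonzeroE:
  assumes "coeff_at (divided_difference i f) \<beta> \<noteq> 0" and ab: "(a, b) \<in> {(i, i + 1), (i + 1, i)}"
  obtains \<gamma> where "coeff_at f \<gamma> \<noteq> 0" "\<And>k. k \<noteq> i \<Longrightarrow> k \<noteq> i + 1 \<Longrightarrow> \<gamma> k = \<beta> k"
    "\<gamma> i + \<gamma> (i + 1) = \<beta> i + \<beta> (i + 1) + 1" "\<gamma> i \<le> \<beta> a \<or> \<gamma> (i + 1) \<le> \<beta> a"
proof -
  define \<beta>' where "\<beta>' = (if a = i then \<beta> else \<beta> \<circ> Transposition.transpose i (i + 1))"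
  have "coeff_at (divided_difference i f) \<beta>' \<noteq> 0"
    using assms(1) by (simp only: \<beta>'_def coeff_at_divided_difference_swap split: if_split) simp
  then have "dd i (coeff_at f) \<beta>' \<noteq> 0" by (simp add: coeff_at_divided_difference)
  then obtain t where t: "t \<le> \<beta>' i"
    "coeff_at f (\<beta>'(i := \<beta>' i + \<beta>' (i + 1) + 1 - t, i + 1 := t)) \<noteq> 0 \<or>
     coeff_at f (\<beta>'(i := t, i + 1 := \<beta>' i + \<beta>' (i + 1) + 1 - t)) \<noteq> 0"
    by (rule dd_nonzeroE)
  have eq: "\<beta>' i = \<beta> a" "\<beta>' i + \<beta>' (i + 1) = \<beta> i + \<beta> (i + 1)"
    using ab by (auto simp: \<beta>'_def)
  have other: "\<beta>' k = \<beta> k" if "k \<noteq> i" "k \<noteq> i + 1" for k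
    using that by (simp add: \<beta>'_def Transposition.transpose_def)
  from t(2) show thesis
  proof
    assume "coeff_at f (\<beta>'(i := \<beta>' i + \<beta>' (i + 1) + 1 - t, i + 1 := t)) \<noteq> 0"
    then show thesis by (rule that) (use t(1) eq other in auto)
  next
    assume "coeff_at f (\<beta>'(i := t, i + 1 := \<beta>' i + \<beta>' (i + 1) + 1 - t)) \<noteq> 0"
    then show thesis by (rule that) (use t(1) eq other in auto)
  qed
qed

section \<open>Codes and nonrecords\<close>

text \<open>The additional hypothesis, that w decreases before i, makes position i a nonrecord as
  seen from any earlier position. This is what keeps U_j and the rotation of records under control
  for j < i.\<close>

lemma first_ascent_induct [consumes 1, case_names longest ascent]:
  assumes w: "w permutes {1..n}"
    and longest: "P (longest_perm n)"
    and ascent: "\<And>w i. w permutes {1..n} \<Longrightarrow> 1 \<le> i \<Longrightarrow> i < n \<Longrightarrow> w i < w (i + 1) \<Longrightarrow>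
      (\<And>k. 1 \<le> k \<Longrightarrow> k < i \<Longrightarrow> w (k + 1) < w k) \<Longrightarrow>
      P (w \<circ> Transposition.transpose i (i + 1)) \<Longrightarrow> P w"
  shows "P w"
  using w
proof (induction "card (noninversions n w)" arbitrary: w rule: less_induct)
  case less
  show ?case
  proof (cases "w = longest_perm n")
    case True
    with longest show ?thesis by simp
  next
    case False
    let ?A = "\<lambda>i. 1 \<le> i \<and> i < n \<and> w i < w (i + 1)"
    from less.prems False have ex: "\<exists>i. ?A i" by (metis exists_ascent)
    define i where "i = (LEAST i. ?A i)"
    have i: "?A i" unfolding i_def using ex by (rule LeastI_ex)
    have "w (k + 1) < w k" if "1 \<le> k" "k < i" for k
    proof -
      have "\<not> ?A k" using that(2) unfolding i_def by (rule not_less_Least)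
      moreover have "w k \<noteq> w (k + 1)" using permutes_inj[OF less.prems]
        by (metis injD less_add_one less_irrefl)
      ultimately show ?thesis using that i by auto
    qed
    with i less.prems show ?thesis
      by (intro ascent[of w i] less.hyps card_noninversions_less permutes_swap) auto
  qed
qed

lemma decreasing_prefix:
  fixes w :: "nat \<Rightarrow> nat"
  assumes "\<And>k. a \<le> k \<Longrightarrow> k < b \<Longrightarrow> w (k + 1) < w k" "a \<le> k" "k < l" "l \<le> b"
  shows "w l < w k"
  using assms(3,4)
proof (induction l)
  case (Suc l)
  then show ?case
    using assms(1)[of l] assms(2) by (cases "k = l") (auto intro: less_trans)
qed simp

text \<open>The Lehmer code, c_k of the overview.\<close>

definition code :: "nat \<Rightarrow> (nat \<Rightarrow> nat) \<Rightarrow> nat \<Rightarrow> nat"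
  where "code n w k = card {l. k < l \<and> l \<le> n \<and> w l < w k}"

text \<open>U_j counts these positions. Position j itself is always a record as seen from j.\<close>

definition nonrecords :: "nat \<Rightarrow> (nat \<Rightarrow> nat) \<Rightarrow> nat \<Rightarrow> nat set"
  where "nonrecords n w j = {l. j < l \<and> l \<le> n \<and> (\<exists>k. j \<le> k \<and> k < l \<and> w l < w k)}"

lemma nonrecordsI: "j < l \<Longrightarrow> l \<le> n \<Longrightarrow> j \<le> k \<Longrightarrow> k < l \<Longrightarrow> w l < w k \<Longrightarrow> l \<in> nonrecords n w j"
  by (auto simp: nonrecords_def)

lemma nonrecordsE:
  assumes "l \<in> nonrecords n w j"
  obtains k where "j < l" "l \<le> n" "j \<le> k" "k < l" "w l < w k"
  using assms by (auto simp: nonrecords_def)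

lemma finite_nonrecords [simp]: "finite (nonrecords n w j)"
  by (rule finite_subset[of _ "{..n}"]) (auto simp: nonrecords_def)

section \<open>Codes and nonrecords under a swap at an ascent\<close>

lemma adjacent_transpose_less_iff:
  fixes l :: nat
  assumes "l \<noteq> i + 1"
  shows "Transposition.transpose i (i + 1) k < l \<longleftrightarrow> k < l"
proof -
  consider "k = i" | "k = i + 1" | "k \<noteq> i" "k \<noteq> i + 1" by blast
  then show ?thesis
  proof cases
    case 3
    then show ?thesis by simp
  qed (use assms in auto)
qed

lemma adjacent_transpose_le_iff:
  fixes l :: nat
  assumes "l \<noteq> i"
  shows "Transposition.transpose i (i + 1) k \<le> l \<longleftrightarrow> k \<le> l"
  using adjacent_transpose_less_iff[of "l + 1" i k] assms by (simp add: less_Suc_eq_le)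

lemma in_transpose_image_iff:
  "l \<in> Transposition.transpose a b ` B \<longleftrightarrow> Transposition.transpose a b l \<in> B"
proof
  assume "Transposition.transpose a b l \<in> B"
  from imageI[OF this, of "Transposition.transpose a b"]
  show "l \<in> Transposition.transpose a b ` B" by simp
qed auto

lemma code_swap_other:
  assumes "1 \<le> i" "i < n" "k \<noteq> i" "k \<noteq> i + 1"
  shows "code n (w \<circ> Transposition.transpose i (i + 1)) k = code n w k"
proof -
  let ?t = "Transposition.transpose i (i + 1)"
  have t: "?t k = k" using assms by simp
  let ?B = "{l. k < l \<and> l \<le> n \<and> w l < w k}"
  have "k < ?t l \<longleftrightarrow> k < l" "?t l \<le> n \<longleftrightarrow> l \<le> n" for l
    using adjacent_transpose_le_iff[of k i l] adjacent_transpose_le_iff[of n i l] assms by auto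
  then have "l \<in> {l. k < l \<and> l \<le> n \<and> (w \<circ> ?t) l < (w \<circ> ?t) k} \<longleftrightarrow> ?t l \<in> ?B" for l
    by (simp only: mem_Collect_eq o_apply t)
  then have "{l. k < l \<and> l \<le> n \<and> (w \<circ> ?t) l < (w \<circ> ?t) k} = ?t ` ?B"
    by (intro set_eqI) (simp only: in_transpose_image_iff)
  then show ?thesis unfolding code_def by (simp only: card_image[OF inj_on_transpose])
qed

lemma code_swap_first:
  assumes "1 \<le> i" "i < n" "w i < w (i + 1)"
  shows "code n (w \<circ> Transposition.transpose i (i + 1)) i = code n w (i + 1) + 1"
proof -
  let ?t = "Transposition.transpose i (i + 1)"
  let ?B = "{l. i + 1 < l \<and> l \<le> n \<and> w l < w (i + 1)}"
  have "{l. i < l \<and> l \<le> n \<and> (w \<circ> ?t) l < (w \<circ> ?t) i} = insert (i + 1) ?B"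
    using assms by (auto simp: Transposition.transpose_def)
  moreover have "finite ?B" by (rule finite_subset[of _ "{..n}"]) auto
  ultimately show ?thesis unfolding code_def by simp
qed

lemma code_swap_second:
  assumes "1 \<le> i" "i < n" "w i < w (i + 1)"
  shows "code n (w \<circ> Transposition.transpose i (i + 1)) (i + 1) = code n w i"
proof -
  let ?t = "Transposition.transpose i (i + 1)"
  have "{l. i + 1 < l \<and> l \<le> n \<and> (w \<circ> ?t) l < (w \<circ> ?t) (i + 1)} =
      {l. i < l \<and> l \<le> n \<and> w l < w i}"
  proof (intro Collect_cong)
    fix l
    show "(i + 1 < l \<and> l \<le> n \<and> (w \<circ> ?t) l < (w \<circ> ?t) (i + 1)) =
      (i < l \<and> l \<le> n \<and> w l < w i)"
      using assms by (cases "l = i + 1") (auto simp: Transposition.transpose_def)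
  qed
  then show ?thesis unfolding code_def by simp
qed

lemma code_ascent_le:
  assumes "w i < w (i + 1)"
  shows "code n w i \<le> code n w (i + 1)"
  unfolding code_def
proof (rule card_mono)
  show "finite {l. i + 1 < l \<and> l \<le> n \<and> w l < w (i + 1)}"
    by (rule finite_subset[of _ "{..n}"]) auto
  show "{l. i < l \<and> l \<le> n \<and> w l < w i} \<subseteq> {l. i + 1 < l \<and> l \<le> n \<and> w l < w (i + 1)}"
  proof
    fix l assume l: "l \<in> {l. i < l \<and> l \<le> n \<and> w l < w i}"
    with assms have "l \<noteq> i + 1" by auto
    with l assms show "l \<in> {l. i + 1 < l \<and> l \<le> n \<and> w l < w (i + 1)}" by auto
  qed
qed

text \<open>The sum of the code is the number of inversions. The swap creates one, which matches the
  degree lost by a divided difference.\<close>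

lemma sum_code_swap:
  assumes "1 \<le> i" "i < n" "w i < w (i + 1)"
  shows "(\<Sum>k\<in>{1..n}. code n (w \<circ> Transposition.transpose i (i + 1)) k) =
    (\<Sum>k\<in>{1..n}. code n w k) + 1"
proof -
  let ?w = "w \<circ> Transposition.transpose i (i + 1)"
  have split: "{1..n} = insert i (insert (i + 1) ({1..n} - {i, i + 1}))" using assms by auto
  have sum: "sum f {1..n} = f i + (f (i + 1) + sum f ({1..n} - {i, i + 1}))" for f :: "nat \<Rightarrow> nat"
    by (subst split) simp
  have "sum (code n ?w) ({1..n} - {i, i + 1}) = sum (code n w) ({1..n} - {i, i + 1})"
    by (rule sum.cong[OF refl], rule code_swap_other) (use assms in auto)
  then show ?thesis unfolding sum code_swap_first[OF assms] code_swap_second[OF assms] by simp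
qed

text \<open>Position i is a nonrecord before the swap because of w (i - 1), and position i + 1 is
  one after it because of the ascent. The value w (i + 1) keeps its status while it moves, so the
  transposition maps one set of nonrecords onto the other.\<close>

lemma card_nonrecords_swap_before:
  assumes "i < n" "w i < w (i + 1)" "1 \<le> j" "j < i" "w i < w (i - 1)"
  shows "card (nonrecords n (w \<circ> Transposition.transpose i (i + 1)) j) = card (nonrecords n w j)"
proof -
  let ?t = "Transposition.transpose i (i + 1)"
  have i: "i \<in> nonrecords n w j" "i + 1 \<in> nonrecords n (w \<circ> ?t) j"
    by (rule nonrecordsI[of _ _ _ "i - 1"], use assms in auto)
      (rule nonrecordsI[of _ _ _ i], use assms in auto)
  have "i + 1 \<in> nonrecords n w j \<longleftrightarrow> (\<exists>k. j \<le> k \<and> k < i \<and> w (i + 1) < w k)"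
  proof
    assume "i + 1 \<in> nonrecords n w j"
    then obtain k where "j \<le> k" "k < i + 1" "w (i + 1) < w k" by (rule nonrecordsE)
    with assms(2) show "\<exists>k. j \<le> k \<and> k < i \<and> w (i + 1) < w k"
      by (intro exI[of _ k]) (auto simp: less_Suc_eq)
  next
    assume "\<exists>k. j \<le> k \<and> k < i \<and> w (i + 1) < w k"
    then obtain k where "j \<le> k" "k < i" "w (i + 1) < w k" by blast
    with assms show "i + 1 \<in> nonrecords n w j" by (intro nonrecordsI[of _ _ _ k]) auto
  qed
  moreover have "i \<in> nonrecords n (w \<circ> ?t) j \<longleftrightarrow> (\<exists>k. j \<le> k \<and> k < i \<and> w (i + 1) < w k)"
  proof
    assume "i \<in> nonrecords n (w \<circ> ?t) j"
    then obtain k where "j \<le> k" "k < i" "(w \<circ> ?t) i < (w \<circ> ?t) k" by (rule nonrecordsE)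
    then show "\<exists>k. j \<le> k \<and> k < i \<and> w (i + 1) < w k" by (intro exI[of _ k]) auto
  next
    assume "\<exists>k. j \<le> k \<and> k < i \<and> w (i + 1) < w k"
    then obtain k where "j \<le> k" "k < i" "w (i + 1) < w k" by blast
    with assms show "i \<in> nonrecords n (w \<circ> ?t) j" by (intro nonrecordsI[of _ _ _ k]) auto
  qed
  ultimately have i': "i + 1 \<in> nonrecords n w j \<longleftrightarrow> i \<in> nonrecords n (w \<circ> ?t) j" by simp
  have "l \<in> nonrecords n (w \<circ> ?t) j \<longleftrightarrow> l \<in> nonrecords n w j" if "l \<noteq> i" "l \<noteq> i + 1" for l
  proof -
    have t: "?t l = l" using that by simp
    have bounds: "j \<le> ?t k \<longleftrightarrow> j \<le> k" "?t k < l \<longleftrightarrow> k < l" for k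
      using adjacent_transpose_less_iff[of j i k] adjacent_transpose_less_iff[of l i k] that assms
      by auto
    show ?thesis
    proof
      assume "l \<in> nonrecords n (w \<circ> ?t) j"
      then show "l \<in> nonrecords n w j"
        by (rule nonrecordsE) (rule nonrecordsI[of _ _ _ "?t _"], auto simp only: bounds t o_apply)
    next
      assume "l \<in> nonrecords n w j"
      then obtain k where k: "j < l" "l \<le> n" "j \<le> k" "k < l" "w l < w k" by (rule nonrecordsE)
      show "l \<in> nonrecords n (w \<circ> ?t) j"
        by (rule nonrecordsI[of _ _ _ "?t k"])
          (use k in \<open>simp_all only: bounds t o_apply transpose_involutory\<close>)
    qed
  qed
  with i i' have iff: "l \<in> nonrecords n (w \<circ> ?t) j \<longleftrightarrow> ?t l \<in> nonrecords n w j" for l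
    by (cases "l = i"; cases "l = i + 1") simp_all
  then have "nonrecords n (w \<circ> ?t) j = ?t ` nonrecords n w j"
    by (intro set_eqI) (simp only: in_transpose_image_iff)
  then show ?thesis by (simp only: card_image[OF inj_on_transpose])
qed

text \<open>Seen from i, a position beyond i + 1 has the same set of earlier values before and after
  the swap. The only change is at i + 1, where the smaller value now follows the larger one.\<close>

lemma nonrecords_swap_first:
  assumes "1 \<le> i" "i < n" "w i < w (i + 1)"
  shows "nonrecords n (w \<circ> Transposition.transpose i (i + 1)) i = insert (i + 1) (nonrecords n w i)"
    and "i + 1 \<notin> nonrecords n w i"
proof -
  let ?t = "Transposition.transpose i (i + 1)"
  show "i + 1 \<notin> nonrecords n w i"
  proof
    assume "i + 1 \<in> nonrecords n w i"
    then obtain k where "i \<le> k" "k < i + 1" "w (i + 1) < w k" by (rule nonrecordsE)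
    moreover from this have "k = i" by linarith
    ultimately show False using assms(3) by simp
  qed
  have "i + 1 \<in> nonrecords n (w \<circ> ?t) i"
    by (rule nonrecordsI[of _ _ _ i]) (use assms in auto)
  moreover have "l \<in> nonrecords n (w \<circ> ?t) i \<longleftrightarrow> l \<in> nonrecords n w i" if "l \<noteq> i + 1" for l
  proof (cases "i + 1 < l")
    case True
    then have t: "?t l = l" by simp
    have bounds: "i \<le> ?t k \<longleftrightarrow> i \<le> k" "?t k < l \<longleftrightarrow> k < l" for k
      using adjacent_transpose_less_iff[of i i k] adjacent_transpose_less_iff[of l i k] True by auto
    show ?thesis
    proof
      assume "l \<in> nonrecords n (w \<circ> ?t) i"
      then show "l \<in> nonrecords n w i"
        by (rule nonrecordsE) (rule nonrecordsI[of _ _ _ "?t _"], auto simp only: bounds t o_apply)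
    next
      assume "l \<in> nonrecords n w i"
      then obtain k where k: "i < l" "l \<le> n" "i \<le> k" "k < l" "w l < w k" by (rule nonrecordsE)
      show "l \<in> nonrecords n (w \<circ> ?t) i"
        by (rule nonrecordsI[of _ _ _ "?t k"])
          (use k in \<open>simp_all only: bounds t o_apply transpose_involutory\<close>)
    qed
  qed (use that in \<open>auto simp: nonrecords_def\<close>)
  ultimately have "l \<in> nonrecords n (w \<circ> ?t) i \<longleftrightarrow> l \<in> insert (i + 1) (nonrecords n w i)" for l
    by (cases "l = i + 1") (simp_all only: insert_iff simp_thms)
  then show "nonrecords n (w \<circ> ?t) i = insert (i + 1) (nonrecords n w i)" by (rule set_eqI)
qed

lemma card_nonrecords_swap_first:
  assumes "1 \<le> i" "i < n" "w i < w (i + 1)"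
  shows "card (nonrecords n (w \<circ> Transposition.transpose i (i + 1)) i) = card (nonrecords n w i) + 1"
  unfolding nonrecords_swap_first(1)[OF assms] using nonrecords_swap_first(2)[OF assms] by simp

text \<open>Position i is dispensable as a witness, since w (i + 1) exceeds w i. This agrees with
  the symmetry of G_w in x_i and x_{i+1}, which gives both variables the same range of
  exponents.\<close>

lemma nonrecords_ascent:
  assumes "w i < w (i + 1)"
  shows "nonrecords n w (i + 1) = nonrecords n w i"
proof (intro equalityI subsetI)
  fix l assume "l \<in> nonrecords n w i"
  then obtain k where l: "i < l" "l \<le> n" and k: "i \<le> k" "k < l" "w l < w k"
    by (auto simp: nonrecords_def)
  have "l \<noteq> i + 1"
  proof
    assume l: "l = i + 1"
    with k have "k = i" by linarith
    with k(3) have "w l < w i" by simp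
    with assms l show False by simp
  qed
  moreover have "\<exists>k. i + 1 \<le> k \<and> k < l \<and> w l < w k"
  proof (cases "k = i")
    case True
    with k assms l \<open>l \<noteq> i + 1\<close> show ?thesis by (intro exI[of _ "i + 1"]) auto
  next
    case False
    with k show ?thesis by (intro exI[of _ k]) auto
  qed
  ultimately show "l \<in> nonrecords n w (i + 1)" using l by (auto simp: nonrecords_def)
next
  fix l assume "l \<in> nonrecords n w (i + 1)"
  then obtain k where "i + 1 < l" "l \<le> n" "i + 1 \<le> k" "k < l" "w l < w k"
    by (rule nonrecordsE)
  then show "l \<in> nonrecords n w i" by (intro nonrecordsI[of _ _ _ k]) auto
qed

lemma nonrecords_swap_second:
  assumes "w i < w (i + 1)"
  shows "nonrecords n (w \<circ> Transposition.transpose i (i + 1)) (i + 1) \<subseteq> nonrecords n w i"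
proof
  fix l assume "l \<in> nonrecords n (w \<circ> Transposition.transpose i (i + 1)) (i + 1)"
  then obtain k where "i + 1 < l" "l \<le> n" "i + 1 \<le> k" "k < l"
    "w l < w (Transposition.transpose i (i + 1) k)"
    by (rule nonrecordsE) simp
  then show "l \<in> nonrecords n w i"
    by (intro nonrecordsI[of _ _ _ "Transposition.transpose i (i + 1) k"])
      (auto simp: Transposition.transpose_def)
qed

lemma nonrecords_swap_after:
  assumes "i + 1 < j"
  shows "nonrecords n (w \<circ> Transposition.transpose i (i + 1)) j = nonrecords n w j"
proof -
  have eq: "(w \<circ> Transposition.transpose i (i + 1)) l = w l" if "j \<le> l" for l
    using that assms by (simp add: Transposition.transpose_def)
  show ?thesis
  proof (intro equalityI subsetI)
    fix l assume "l \<in> nonrecords n (w \<circ> Transposition.transpose i (i + 1)) j"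
    then show "l \<in> nonrecords n w j"
      by (rule nonrecordsE) (rule nonrecordsI, assumption+, simp only: eq[OF less_imp_le] eq)
  next
    fix l assume "l \<in> nonrecords n w j"
    then obtain k where k: "j < l" "l \<le> n" "j \<le> k" "k < l" "w l < w k" by (rule nonrecordsE)
    then have "(w \<circ> Transposition.transpose i (i + 1)) l < (w \<circ> Transposition.transpose i (i + 1)) k"
      using eq[of l] eq[of k] by simp
    with k show "l \<in> nonrecords n (w \<circ> Transposition.transpose i (i + 1)) j"
      by (intro nonrecordsI[of _ _ _ k])
  qed
qed

section \<open>Bounds on the support\<close>

lemma X_power: "X i ^ k = Poly_Mapping.single (Poly_Mapping.single i k) 1"
proof (induction k)
  case (Suc k)
  have "Poly_Mapping.single i (Suc k) = Poly_Mapping.single i 1 + Poly_Mapping.single i k"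
    by (simp flip: single_add)
  with Suc show ?case by (simp only: power_Suc) (simp only: X_def mult_single mult_1)
qed simp

lemma prod_X_power:
  assumes "finite A"
  shows "(\<Prod>i\<in>A. X i ^ e i) =
    Poly_Mapping.single (\<Sum>i\<in>A. Poly_Mapping.single i (e i)) 1"
  using assms
proof induction
  case (insert i A)
  then show ?case by (simp add: X_power mult_single)
qed simp

lemma coeff_at_longest:
  "coeff_at (grothendieck n (longest_perm n)) \<beta> =
    (if \<beta> = (\<lambda>k. if k \<in> {1..n} then n - k else 0) then 1 else 0)"
proof -
  define \<alpha> :: "nat \<Rightarrow>\<^sub>0 nat" where "\<alpha> = (\<Sum>i\<in>{1..<n}. Poly_Mapping.single i (n - i))"
  have \<alpha>: "Poly_Mapping.lookup \<alpha> = (\<lambda>k. if k \<in> {1..n} then n - k else 0)"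
    by (auto simp: \<alpha>_def fun_eq_iff lookup_sum lookup_single when_def)
  have g: "grothendieck n (longest_perm n) = Poly_Mapping.single \<alpha> 1"
    by (simp add: grothendieck_longest prod_X_power \<alpha>_def)
  show ?thesis
  proof (cases "coeff_at (grothendieck n (longest_perm n)) \<beta> = 0")
    case True
    then have "\<beta> \<noteq> Poly_Mapping.lookup \<alpha>" by (auto simp: g coeff_at_lookup)
    with True show ?thesis by (simp add: \<alpha>)
  next
    case False
    then obtain \<gamma> where "\<beta> = Poly_Mapping.lookup \<gamma>" "\<gamma> \<in> Poly_Mapping.keys (Poly_Mapping.single \<alpha> (1::int))"
      unfolding g by (rule coeff_at_nonzeroE)
    then have "\<beta> = Poly_Mapping.lookup \<alpha>" by simp
    moreover from this have "coeff_at (grothendieck n (longest_perm n)) \<beta> = 1"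
      by (simp add: g coeff_at_lookup)
    ultimately show ?thesis by (simp add: \<alpha>)
  qed
qed

section \<open>Tracing monomials back through one step of the recursion\<close>

lemma coeff_at_one_minus_X_times:
  "coeff_at ((1 - X i) * g) \<beta> =
    coeff_at g \<beta> - (if \<beta> i = 0 then 0 else coeff_at g (\<beta>(i := \<beta> i - 1)))"
  by (simp add: left_diff_distrib coeff_at_diff coeff_at_X_times)

text \<open>Some term of the divided difference must be nonzero, and it stems from a monomial of the
  polynomial for the swapped permutation, possibly multiplied by x_{i+1}. Undoing that
  multiplication costs one power of x_{i+1} but none of x_i, hence \<open>\<beta> b\<close> in one
  alternative and \<open>\<beta> b + 1\<close> in the other. The role a serves lower bounds on an
  exponent of \<beta>, the role b upper bounds.\<close>

lemma grothendieck_support_ascent: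
  assumes "w permutes {1..n}" "1 \<le> i" "i < n" "w i < w (i + 1)"
    and nz: "coeff_at (grothendieck n w) \<beta> \<noteq> 0" and ab: "(a, b) \<in> {(i, i + 1), (i + 1, i)}"
  shows "\<exists>\<gamma>. coeff_at (grothendieck n (w \<circ> Transposition.transpose i (i + 1))) \<gamma> \<noteq> 0 \<and>
    (\<forall>k. k \<noteq> i \<longrightarrow> k \<noteq> i + 1 \<longrightarrow> \<gamma> k = \<beta> k) \<and>
    \<gamma> i + \<gamma> (i + 1) \<le> \<beta> i + \<beta> (i + 1) + 1 \<and>
    (\<gamma> i \<le> \<beta> a \<and> \<beta> b \<le> \<gamma> (i + 1) \<or> \<gamma> (i + 1) \<le> \<beta> a \<and> \<beta> b + 1 \<le> \<gamma> i)"
proof -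
  let ?g = "grothendieck n (w \<circ> Transposition.transpose i (i + 1))"
  obtain \<gamma> where \<gamma>: "coeff_at ((1 - X (i + 1)) * ?g) \<gamma> \<noteq> 0"
    "\<And>k. k \<noteq> i \<Longrightarrow> k \<noteq> i + 1 \<Longrightarrow> \<gamma> k = \<beta> k"
    "\<gamma> i + \<gamma> (i + 1) = \<beta> i + \<beta> (i + 1) + 1" "\<gamma> i \<le> \<beta> a \<or> \<gamma> (i + 1) \<le> \<beta> a"
    using nz[unfolded grothendieck_ascent[OF assms(1-4)]] ab
    by (rule divided_difference_nonzeroE) (rule that, auto)
  show ?thesis
  proof (cases "coeff_at ?g \<gamma> = 0")
    case False
    then show ?thesis using \<gamma>(2-4) ab by (intro exI[of _ \<gamma>]) auto
  next
    case True
    with \<gamma>(1) have "\<gamma> (i + 1) \<noteq> 0" "coeff_at ?g (\<gamma>(i + 1 := \<gamma> (i + 1) - 1)) \<noteq> 0"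
      by (simp_all add: coeff_at_one_minus_X_times split: if_splits)
    with \<gamma>(2-4) ab show ?thesis by (intro exI[of _ "\<gamma>(i + 1 := \<gamma> (i + 1) - 1)"]) auto
  qed
qed

lemma grothendieck_support_vars:
  assumes "w permutes {1..n}" "coeff_at (grothendieck n w) \<beta> \<noteq> 0" "k \<notin> {1..n}"
  shows "\<beta> k = 0"
  using assms(1,2)
proof (induction arbitrary: \<beta> rule: first_ascent_induct)
  case longest
  then show ?case using assms(3) by (auto simp: coeff_at_longest split: if_splits)
next
  case (ascent w i)
  from grothendieck_support_ascent[OF ascent(1-4,7) insertI1]
  obtain \<gamma> where \<gamma>: "coeff_at (grothendieck n (w \<circ> Transposition.transpose i (i + 1))) \<gamma> \<noteq> 0"
    "\<forall>k. k \<noteq> i \<longrightarrow> k \<noteq> i + 1 \<longrightarrow> \<gamma> k = \<beta> k"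
    "\<gamma> i + \<gamma> (i + 1) \<le> \<beta> i + \<beta> (i + 1) + 1"
    "\<gamma> i \<le> \<beta> i \<and> \<beta> (i + 1) \<le> \<gamma> (i + 1) \<or> \<gamma> (i + 1) \<le> \<beta> i \<and> \<beta> (i + 1) + 1 \<le> \<gamma> i"
    by (elim exE conjE)
  have "k \<noteq> i" "k \<noteq> i + 1" using ascent(2,3) assms(3) by auto
  with \<gamma>(2) ascent(6)[OF \<gamma>(1)] show ?case by (simp only: simp_thms)
qed

lemma code_longest: "k \<in> {1..n} \<Longrightarrow> code n (longest_perm n) k = n - k"
proof -
  assume "k \<in> {1..n}"
  then have "{l. k < l \<and> l \<le> n \<and> longest_perm n l < longest_perm n k} = {k<..n}"
    by (auto simp: longest_perm_def)
  then show ?thesis by (simp add: code_def)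
qed

lemma nonrecords_longest:
  assumes "1 \<le> j"
  shows "nonrecords n (longest_perm n) j = {j<..n}"
  using assms by (auto simp: nonrecords_def longest_perm_def intro!: exI[of _ j])

text \<open>The swap moves the code entry of i to i + 1, so a bound by the single entry at k would
  not survive the induction; a bound by some entry of the prefix up to k does.\<close>

lemma grothendieck_support_lower:
  assumes "w permutes {1..n}" "coeff_at (grothendieck n w) \<beta> \<noteq> 0" "k \<in> {1..n}"
  shows "\<exists>l\<in>{1..k}. code n w l \<le> \<beta> k"
  using assms
proof (induction arbitrary: \<beta> k rule: first_ascent_induct)
  case longest
  then show ?case
    using code_longest[of k n]
    by (intro bexI[of _ k]) (auto simp: coeff_at_longest split: if_splits)
next
  case (ascent w i)
  let ?w = "w \<circ> Transposition.transpose i (i + 1)"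
  note i = ascent(2-4)
  \<comment> \<open>Both swapped entries of \<open>?w\<close> are at least
    \<open>code n w i\<close>. Since i lies in the prefix of either position, a prefix ending at i +
    1 may be exchanged for one ending at i.\<close>
  have code: "\<exists>l\<in>{1..k}. code n w l \<le> b"
    if "\<exists>l\<in>{1..k'}. code n ?w l \<le> b" "k' = k \<and> k \<noteq> i \<or> k' \<in> {i, i + 1} \<and> k \<in> {i, i + 1}" for b k k'
  proof -
    from that(1) obtain l where l: "l \<in> {1..k'}" "code n ?w l \<le> b" by blast
    consider "l = i" | "l = i + 1" | "l \<noteq> i" "l \<noteq> i + 1" by blast
    then show ?thesis
    proof cases
      case 1
      with l(2) have "code n w (i + 1) + 1 \<le> b" by (simp only: code_swap_first[OF i])
      with code_ascent_le[OF i(3), of n] have "code n w i \<le> b" by linarith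
      with 1 l that(2) i show ?thesis by (intro bexI[of _ i]) auto
    next
      case 2
      with l(2) have "code n w i \<le> b" by (simp only: code_swap_second[OF i])
      with 2 l that(2) i show ?thesis by (intro bexI[of _ i]) auto
    next
      case 3
      from l(2) have "code n w l \<le> b" by (simp only: code_swap_other[OF i(1,2) 3])
      with 3 l that(2) i show ?thesis by (intro bexI[of _ l]) auto
    qed
  qed
  show ?case
  proof (cases "k = i \<or> k = i + 1")
    case False
    from grothendieck_support_ascent[OF ascent(1-4,7) insertI1]
    obtain \<gamma> where \<gamma>: "coeff_at (grothendieck n ?w) \<gamma> \<noteq> 0"
      "\<forall>k. k \<noteq> i \<longrightarrow> k \<noteq> i + 1 \<longrightarrow> \<gamma> k = \<beta> k"
      "\<gamma> i + \<gamma> (i + 1) \<le> \<beta> i + \<beta> (i + 1) + 1"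
      "\<gamma> i \<le> \<beta> i \<and> \<beta> (i + 1) \<le> \<gamma> (i + 1) \<or> \<gamma> (i + 1) \<le> \<beta> i \<and> \<beta> (i + 1) + 1 \<le> \<gamma> i"
      by (elim exE conjE)
    have "\<gamma> k = \<beta> k" using \<gamma>(2) False by blast
    with ascent(6)[OF \<gamma>(1) ascent(8)] have "\<exists>l\<in>{1..k}. code n ?w l \<le> \<beta> k"
      by (simp only:)
    then show ?thesis by (rule code) (use False in auto)
  next
    case True
    \<comment> \<open>Here k takes the role of a: one of the two exponents of \<gamma> is at most
      \<open>\<beta> k\<close>.\<close>
    then obtain b where "(k, b) \<in> {(i, i + 1), (i + 1, i)}" by auto
    from grothendieck_support_ascent[OF ascent(1-4,7) this]
    obtain \<gamma> where \<gamma>: "coeff_at (grothendieck n ?w) \<gamma> \<noteq> 0"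
      "\<forall>k. k \<noteq> i \<longrightarrow> k \<noteq> i + 1 \<longrightarrow> \<gamma> k = \<beta> k"
      "\<gamma> i + \<gamma> (i + 1) \<le> \<beta> i + \<beta> (i + 1) + 1"
      "\<gamma> i \<le> \<beta> k \<and> \<beta> b \<le> \<gamma> (i + 1) \<or> \<gamma> (i + 1) \<le> \<beta> k \<and> \<beta> b + 1 \<le> \<gamma> i"
      by (elim exE conjE)
    obtain k' where k': "k' \<in> {i, i + 1}" "\<gamma> k' \<le> \<beta> k" using \<gamma>(4) by blast
    have "\<exists>l\<in>{1..k'}. code n ?w l \<le> \<gamma> k'" by (rule ascent(6)[OF \<gamma>(1)]) (use k' i in auto)
    with k'(2) have "\<exists>l\<in>{1..k'}. code n ?w l \<le> \<beta> k" by (meson order_trans)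
    then show ?thesis by (rule code) (use True k' in auto)
  qed
qed

text \<open>Away from the ascent, neither the exponent nor the count changes. At the ascent, the
  bound on x_i for the swapped permutation is too large by one, and the sharper alternative
  \<open>\<beta> b + 1 \<le> \<gamma> i\<close> of the support step makes up for this.\<close>

lemma grothendieck_support_upper:
  assumes "w permutes {1..n}" "coeff_at (grothendieck n w) \<beta> \<noteq> 0" "1 \<le> j"
  shows "\<beta> j \<le> card (nonrecords n w j)"
  using assms
proof (induction arbitrary: \<beta> j rule: first_ascent_induct)
  case longest
  then show ?case by (auto simp: coeff_at_longest nonrecords_longest split: if_splits)
next
  case (ascent w i)
  let ?w = "w \<circ> Transposition.transpose i (i + 1)"
  note i = ascent(2-4)
  show ?case
  proof (cases "j = i \<or> j = i + 1")
    case False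
    from grothendieck_support_ascent[OF ascent(1-4,7) insertI1]
    obtain \<gamma> where \<gamma>: "coeff_at (grothendieck n ?w) \<gamma> \<noteq> 0"
      "\<forall>k. k \<noteq> i \<longrightarrow> k \<noteq> i + 1 \<longrightarrow> \<gamma> k = \<beta> k"
      "\<gamma> i + \<gamma> (i + 1) \<le> \<beta> i + \<beta> (i + 1) + 1"
      "\<gamma> i \<le> \<beta> i \<and> \<beta> (i + 1) \<le> \<gamma> (i + 1) \<or> \<gamma> (i + 1) \<le> \<beta> i \<and> \<beta> (i + 1) + 1 \<le> \<gamma> i"
      by (elim exE conjE)
    have "\<gamma> j = \<beta> j" using \<gamma>(2) False by blast
    with ascent(6)[OF \<gamma>(1) ascent(8)] have "\<beta> j \<le> card (nonrecords n ?w j)"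
      by (simp only:)
    moreover have "card (nonrecords n ?w j) = card (nonrecords n w j)"
    proof (cases "j < i")
      case True
      then have "w i < w (i - 1)" using ascent(5)[of "i - 1"] ascent(8) by simp
      then show ?thesis by (rule card_nonrecords_swap_before[OF i(2,3) ascent(8) True])
    next
      case False
      with \<open>\<not> (j = i \<or> j = i + 1)\<close> have "i + 1 < j" by simp
      then show ?thesis by (simp only: nonrecords_swap_after)
    qed
    ultimately show ?thesis by simp
  next
    case True
    \<comment> \<open>Here j takes the role of b, so that \<open>\<beta> j\<close> is at most
      \<open>\<gamma> (i + 1)\<close> or at most \<open>\<gamma> i - 1\<close>.\<close>
    then obtain a where "(a, j) \<in> {(i, i + 1), (i + 1, i)}" by auto
    from grothendieck_support_ascent[OF ascent(1-4,7) this]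
    obtain \<gamma> where \<gamma>: "coeff_at (grothendieck n ?w) \<gamma> \<noteq> 0"
      "\<forall>k. k \<noteq> i \<longrightarrow> k \<noteq> i + 1 \<longrightarrow> \<gamma> k = \<beta> k"
      "\<gamma> i + \<gamma> (i + 1) \<le> \<beta> i + \<beta> (i + 1) + 1"
      "\<gamma> i \<le> \<beta> a \<and> \<beta> j \<le> \<gamma> (i + 1) \<or> \<gamma> (i + 1) \<le> \<beta> a \<and> \<beta> j + 1 \<le> \<gamma> i"
      by (elim exE conjE)
    have "\<gamma> i \<le> card (nonrecords n w i) + 1"
      using ascent(6)[OF \<gamma>(1) i(1)] by (simp only: card_nonrecords_swap_first[OF i])
    moreover have "\<gamma> (i + 1) \<le> card (nonrecords n w i)"
      using ascent(6)[OF \<gamma>(1), of "i + 1"] by (rule order_trans)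
        (simp_all only: le_add2 card_mono[OF finite_nonrecords nonrecords_swap_second[OF i(3)]])
    moreover have "nonrecords n w j = nonrecords n w i"
      using True by (elim disjE) (simp_all only: nonrecords_ascent[OF i(3)])
    ultimately show ?thesis using \<gamma>(4) by (elim disjE conjE) simp_all
  qed
qed

section \<open>Degrees and the lowest-degree component\<close>

lemma sum_eq_pair:
  fixes \<beta> :: "nat \<Rightarrow> nat"
  assumes "1 \<le> i" "i < n"
  shows "sum \<beta> {1..n} = \<beta> i + \<beta> (i + 1) + sum \<beta> ({1..n} - {i, i + 1})"
proof -
  have "{1..n} = insert i (insert (i + 1) ({1..n} - {i, i + 1}))" using assms by auto
  then have "sum \<beta> {1..n} = sum \<beta> (insert i (insert (i + 1) ({1..n} - {i, i + 1})))" by simp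
  then show ?thesis by simp
qed

text \<open>A divided difference lowers the degree by one and multiplication by 1 - x_{i+1} never
  lowers it, while the number of inversions drops by one in each step of the recursion.\<close>

lemma grothendieck_support_degree:
  assumes "w permutes {1..n}" "coeff_at (grothendieck n w) \<beta> \<noteq> 0"
  shows "sum (code n w) {1..n} \<le> sum \<beta> {1..n}"
  using assms
proof (induction arbitrary: \<beta> rule: first_ascent_induct)
  case longest
  have "sum (code n (longest_perm n)) {1..n} = sum \<beta> {1..n}"
    by (rule sum.cong) (use longest in \<open>auto simp: coeff_at_longest code_longest split: if_splits\<close>)
  then show ?case by simp
next
  case (ascent w i)
  from grothendieck_support_ascent[OF ascent(1-4,7) insertI1]
  obtain \<gamma> where \<gamma>: "coeff_at (grothendieck n (w \<circ> Transposition.transpose i (i + 1))) \<gamma> \<noteq> 0"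
    "\<forall>k. k \<noteq> i \<longrightarrow> k \<noteq> i + 1 \<longrightarrow> \<gamma> k = \<beta> k"
    "\<gamma> i + \<gamma> (i + 1) \<le> \<beta> i + \<beta> (i + 1) + 1"
    "\<gamma> i \<le> \<beta> i \<and> \<beta> (i + 1) \<le> \<gamma> (i + 1) \<or> \<gamma> (i + 1) \<le> \<beta> i \<and> \<beta> (i + 1) + 1 \<le> \<gamma> i"
    by (elim exE conjE)
  have "sum \<gamma> ({1..n} - {i, i + 1}) = sum \<beta> ({1..n} - {i, i + 1})"
    by (rule sum.cong) (use \<gamma>(2) in auto)
  with \<gamma>(3) have "sum \<gamma> {1..n} \<le> sum \<beta> {1..n} + 1"
    using sum_eq_pair[OF ascent(2,3), of \<gamma>] sum_eq_pair[OF ascent(2,3), of \<beta>] by linarith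
  with ascent(6)[OF \<gamma>(1)] show ?case using sum_code_swap[OF ascent(2-4)] by linarith
qed

text \<open>
  The coefficients of the lowest-degree component of the Grothendieck polynomial, that is, of the
  Schubert polynomial of \<open>w\<close>.
\<close>

definition schubert :: "nat \<Rightarrow> (nat \<Rightarrow> nat) \<Rightarrow> (nat \<Rightarrow> nat) \<Rightarrow> int"
  where "schubert n w \<beta> =
    (if sum \<beta> {1..n} = sum (code n w) {1..n} then coeff_at (grothendieck n w) \<beta> else 0)"

lemma schubert_nonzero: "schubert n w \<beta> \<noteq> 0 \<Longrightarrow> coeff_at (grothendieck n w) \<beta> \<noteq> 0"
  by (simp add: schubert_def split: if_splits)

lemma schubert_longest:
  "schubert n (longest_perm n) \<beta> =
    (if \<beta> = (\<lambda>k. if k \<in> {1..n} then n - k else 0) then 1 else 0)"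
proof -
  have "(\<Sum>k\<in>{1..n}. if k \<in> {1..n} then n - k else 0) = sum (code n (longest_perm n)) {1..n}"
    by (rule sum.cong) (auto simp: code_longest)
  then show ?thesis by (auto simp: schubert_def coeff_at_longest)
qed

text \<open>In the degree in question the factor 1 - x_{i+1} acts as 1: the term with x_{i+1} would
  need a monomial of the swapped polynomial below its lowest degree. This is the recursion of the
  Schubert polynomials.\<close>

lemma schubert_ascent:
  assumes "w permutes {1..n}" "1 \<le> i" "i < n" "w i < w (i + 1)"
  shows "schubert n w = dd i (schubert n (w \<circ> Transposition.transpose i (i + 1)))"
proof
  fix \<beta> :: "nat \<Rightarrow> nat"
  let ?w = "w \<circ> Transposition.transpose i (i + 1)"
  let ?g = "grothendieck n ?w"
  have w: "?w permutes {1..n}" by (rule permutes_swap[OF assms(1-3)])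
  have deg: "sum (\<beta>(i := x, i + 1 := y)) {1..n} = sum \<beta> {1..n} + 1"
    if "x + y = \<beta> i + \<beta> (i + 1) + 1" for x y
  proof -
    have "sum (\<beta>(i := x, i + 1 := y)) ({1..n} - {i, i + 1}) = sum \<beta> ({1..n} - {i, i + 1})"
      by (rule sum.cong) auto
    then show ?thesis
      using that sum_eq_pair[OF assms(2,3), of \<beta>]
        sum_eq_pair[OF assms(2,3), of "\<beta>(i := x, i + 1 := y)"] by simp
  qed
  show "schubert n w \<beta> = dd i (schubert n ?w) \<beta>"
  proof (cases "sum \<beta> {1..n} = sum (code n w) {1..n}")
    case False
    have zero: "schubert n ?w (\<beta>(i := x, i + 1 := y)) = 0"
      if "x + y = \<beta> i + \<beta> (i + 1) + 1" for x y
      unfolding schubert_def deg[OF that] sum_code_swap[OF assms(2-4)] using False by simp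
    have "dd i (schubert n ?w) \<beta> = 0"
      unfolding dd_def
    proof (intro sum.neutral ballI)
      fix t assume "t \<in> {..\<beta> i}"
      then show "schubert n ?w (\<beta>(i := \<beta> i + \<beta> (i + 1) + 1 - t, i + 1 := t)) -
          schubert n ?w (\<beta>(i := t, i + 1 := \<beta> i + \<beta> (i + 1) + 1 - t)) = 0"
        by (subst (1 2) zero) auto
    qed
    with False show ?thesis by (simp add: schubert_def)
  next
    case True
    have low: "coeff_at ((1 - X (i + 1)) * ?g) \<gamma> = schubert n ?w \<gamma>"
      if "sum \<gamma> {1..n} = sum \<beta> {1..n} + 1" for \<gamma>
    proof -
      have \<gamma>: "schubert n ?w \<gamma> = coeff_at ?g \<gamma>"
        unfolding schubert_def that sum_code_swap[OF assms(2-4)] using True by simp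
      show ?thesis
      proof (cases "\<gamma> (i + 1) = 0")
        case True
        then show ?thesis unfolding \<gamma> coeff_at_one_minus_X_times by simp
      next
        case False
        let ?\<gamma> = "\<gamma>(i + 1 := \<gamma> (i + 1) - 1)"
        have "sum ?\<gamma> ({1..n} - {i, i + 1}) = sum \<gamma> ({1..n} - {i, i + 1})"
          by (rule sum.cong) auto
        then have "sum ?\<gamma> {1..n} < sum \<gamma> {1..n}"
          using False sum_eq_pair[OF assms(2,3), of ?\<gamma>] sum_eq_pair[OF assms(2,3), of \<gamma>] by simp
        then have "\<not> sum (code n ?w) {1..n} \<le> sum ?\<gamma> {1..n}"
          using that True sum_code_swap[OF assms(2-4)] by linarith
        then have "coeff_at ?g ?\<gamma> = 0" using grothendieck_support_degree[OF w] by blast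
        then show ?thesis unfolding \<gamma> coeff_at_one_minus_X_times by (simp only: if_cancel diff_zero)
      qed
    qed
    have "schubert n w \<beta> = dd i (coeff_at ((1 - X (i + 1)) * ?g)) \<beta>"
      using True
      by (simp add: schubert_def grothendieck_ascent[OF assms] coeff_at_divided_difference)
    also have "\<dots> = dd i (schubert n ?w) \<beta>"
      unfolding dd_def
    proof (rule sum.cong[OF refl])
      fix t assume "t \<in> {..\<beta> i}"
      then have "\<beta> i + \<beta> (i + 1) + 1 - t + t = \<beta> i + \<beta> (i + 1) + 1"
        "t + (\<beta> i + \<beta> (i + 1) + 1 - t) = \<beta> i + \<beta> (i + 1) + 1" by auto
      then show "coeff_at ((1 - X (i + 1)) * ?g) (\<beta>(i := \<beta> i + \<beta> (i + 1) + 1 - t, i + 1 := t)) -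
          coeff_at ((1 - X (i + 1)) * ?g) (\<beta>(i := t, i + 1 := \<beta> i + \<beta> (i + 1) + 1 - t)) =
        schubert n ?w (\<beta>(i := \<beta> i + \<beta> (i + 1) + 1 - t, i + 1 := t)) -
          schubert n ?w (\<beta>(i := t, i + 1 := \<beta> i + \<beta> (i + 1) + 1 - t))"
        by (simp only: low deg)
    qed
    finally show ?thesis .
  qed
qed

section \<open>Minimal slices of Schubert polynomials\<close>

text \<open>
  The slices below only concern \<open>w\<close> whose first \<open>j - 1\<close> values are \<open>n, n - 1, \<dots>\<close>.  Such rows
  contribute the fixed monomial factor $x_1^{n-1} \cdots x_{j-1}^{n-j+1}$, so that normalising a
  row to this form amounts to deleting it.
\<close>

definition top_rows :: "nat \<Rightarrow> nat \<Rightarrow> (nat \<Rightarrow> nat) \<Rightarrow> bool"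
  where "top_rows n j w \<longleftrightarrow> w permutes {1..n} \<and> (\<forall>k\<in>{1..<j}. w k = n + 1 - k)"

lemma top_rows_le:
  assumes w: "top_rows n j w" and l: "j \<le> l" "l \<le> n"
  shows "w l \<le> n + 1 - j"
proof (rule ccontr)
  assume "\<not> ?thesis"
  moreover have "w l \<in> {1..n}" if "1 \<le> l"
    using permutes_in_image[of w "{1..n}" l] w l that by (auto simp: top_rows_def)
  moreover have "w 0 = 0" using permutes_not_in[of w "{1..n}" 0] w by (auto simp: top_rows_def)
  ultimately have "1 \<le> l" "w l \<le> n" "n + 1 - j < w l" by (cases "l = 0"; auto)+
  \<comment> \<open>A value above n + 1 - j is already taken, namely by the row n + 1 - w l, which
    lies before j.\<close>
  then have m: "n + 1 - w l \<in> {1..<j}" by auto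
  then have "w (n + 1 - w l) = w l"
    using w \<open>w l \<le> n\<close> by (simp only: top_rows_def)
  then have "n + 1 - w l = l"
    using permutes_inj[of w "{1..n}"] w by (metis injD top_rows_def)
  with m l show False by simp
qed

lemma top_rows_code:
  assumes w: "top_rows n j w" and k: "k \<in> {1..<j}" "k \<le> n"
  shows "code n w k = n - k"
proof -
  have "w l < w k" if "k < l" "l \<le> n" for l
  proof -
    have "top_rows n (k + 1) w" using w k by (auto simp: top_rows_def)
    then have "w l \<le> n + 1 - (k + 1)" by (rule top_rows_le) (use that in auto)
    moreover have "w k = n + 1 - k" using w k by (auto simp: top_rows_def)
    ultimately show ?thesis using k by auto
  qed
  then have "{l. k < l \<and> l \<le> n \<and> w l < w k} = {k<..n}" by auto
  then show ?thesis by (simp add: code_def)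
qed

lemma top_rows_swap:
  assumes "top_rows n j w" "1 \<le> i" "i < n" "j \<le> i"
  shows "top_rows n j (w \<circ> Transposition.transpose i (i + 1))"
  using assms permutes_swap[of w n i] by (auto simp: top_rows_def)

lemma top_rows_longest:
  assumes w: "top_rows n j w" and desc: "\<And>k. 1 \<le> k \<Longrightarrow> j \<le> k \<Longrightarrow> k < n \<Longrightarrow> w (k + 1) < w k"
  shows "w = longest_perm n"
proof (rule ccontr)
  assume "w \<noteq> longest_perm n"
  moreover have "w permutes {1..n}" using w by (simp add: top_rows_def)
  ultimately obtain i where i: "1 \<le> i" "i < n" "w i < w (i + 1)" using exists_ascent by blast
  then have "i < j" using desc[of i] by (cases "j \<le> i") auto
  then have "top_rows n (i + 1) w" using w by (auto simp: top_rows_def)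
  then have "w (i + 1) \<le> n + 1 - (i + 1)" by (rule top_rows_le) (use i in auto)
  moreover have "w i = n + 1 - i" using w i \<open>i < j\<close> by (auto simp: top_rows_def)
  ultimately show False using i by simp
qed

lemma top_rows_Suc:
  assumes "top_rows n j w" "w j = n + 1 - j"
  shows "top_rows n (j + 1) w"
  using assms by (auto simp: top_rows_def less_Suc_eq)

definition cycle_up :: "nat \<Rightarrow> nat \<Rightarrow> nat \<Rightarrow> nat"
  where "cycle_up v N x = (if x = v then N else if v < x \<and> x \<le> N then x - 1 else x)"

lemma cycle_up_permutes:
  assumes "1 \<le> v" "v \<le> N" "N \<le> n"
  shows "cycle_up v N permutes {1..n}"
proof (rule bij_imp_permutes)
  define g where "g x = (if x = N then v else if v \<le> x \<and> x < N then x + 1 else x)" for x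
  show "bij_betw (cycle_up v N) {1..n} {1..n}"
    by (rule bij_betw_byWitness[where f' = g]) (use assms in \<open>auto simp: cycle_up_def g_def\<close>)
qed (use assms in \<open>auto simp: cycle_up_def\<close>)

lemma cycle_up_less_iff:
  assumes "x \<noteq> v" "y \<noteq> v"
  shows "cycle_up v N x < cycle_up v N y \<longleftrightarrow> x < y"
  using assms by (auto simp: cycle_up_def)

text \<open>The normalised deletion of row j: its value becomes n + 1 - j, the largest one still
  available, and the other rows keep their relative order.\<close>

definition raise :: "nat \<Rightarrow> nat \<Rightarrow> (nat \<Rightarrow> nat) \<Rightarrow> nat \<Rightarrow> nat"
  where "raise n j w = cycle_up (w j) (n + 1 - j) \<circ> w"

lemma raise_top_rows:
  assumes w: "top_rows n j w" and j: "1 \<le> j" "j \<le> n"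
  shows "top_rows n (j + 1) (raise n j w)"
proof -
  have p: "w permutes {1..n}" using w by (simp add: top_rows_def)
  have "w j \<le> n + 1 - j" by (rule top_rows_le[OF w]) (use j in auto)
  moreover have "1 \<le> w j" using permutes_in_image[OF p, of j] j by auto
  ultimately have "raise n j w permutes {1..n}"
    unfolding raise_def by (intro permutes_compose[OF p] cycle_up_permutes) (use j in auto)
  moreover have "raise n j w k = n + 1 - k" if "k \<in> {1..<j}" for k
  proof -
    have "w k = n + 1 - k" using w that by (auto simp: top_rows_def)
    with \<open>w j \<le> n + 1 - j\<close> that j show ?thesis by (auto simp: raise_def cycle_up_def)
  qed
  moreover have "raise n j w j = n + 1 - j" by (simp add: raise_def cycle_up_def)
  ultimately show ?thesis by (auto simp: top_rows_def less_Suc_eq)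
qed

lemma raise_less_iff:
  assumes "inj w" "k \<noteq> j" "l \<noteq> j"
  shows "raise n j w k < raise n j w l \<longleftrightarrow> w k < w l"
  using assms by (simp add: raise_def cycle_up_less_iff inj_eq)

text \<open>
  Here \<open>code n w j\<close> is the least exponent of $x_j$.  The induction uses ascents after \<open>j\<close>, whose
  divided differences do not touch $x_j$, and the ascent at \<open>j\<close> only once the remaining values
  decrease.
\<close>

lemma schubert_min_slice:
  assumes "top_rows n j w" "1 \<le> j" "j \<le> n" "\<alpha> j = code n w j"
  shows "schubert n w \<alpha> = schubert n (raise n j w) (\<alpha>(j := n - j))"
  using assms
proof (induction "card (noninversions n w)" arbitrary: w j \<alpha> rule: less_induct)
  case less
  note w = less.prems(1) and j = less.prems(2,3) and \<alpha> = less.prems(4)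
  have p: "w permutes {1..n}" using w by (simp add: top_rows_def)
  then have inj: "inj w" by (rule permutes_inj)
  have r: "top_rows n (j + 1) (raise n j w)" by (rule raise_top_rows[OF w j])
  then have rp: "raise n j w permutes {1..n}" by (simp add: top_rows_def)
  show ?case
  proof (cases "\<exists>i. j < i \<and> i < n \<and> w i < w (i + 1)")
    case True
    then obtain i where i: "j < i" "i < n" "w i < w (i + 1)" by blast
    let ?t = "Transposition.transpose i (i + 1)"
    have i1: "1 \<le> i" using i by simp
    have tj: "(w \<circ> ?t) j = w j" using i by simp
    \<comment> \<open>\<open>raise\<close> relabels values and the swap moves positions; they
      commute because the swap fixes position j.\<close>
    have comp: "raise n j (w \<circ> ?t) = raise n j w \<circ> ?t"
      unfolding raise_def tj by (simp only: comp_assoc)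
    have IH: "schubert n (w \<circ> ?t) \<beta> = schubert n (raise n j w \<circ> ?t) (\<beta>(j := n - j))"
      if "\<beta> j = \<alpha> j" for \<beta>
      unfolding comp[symmetric]
    proof (rule less.hyps)
      show "card (noninversions n (w \<circ> ?t)) < card (noninversions n w)"
        by (rule card_noninversions_less[OF i1 i(2,3)])
      show "top_rows n j (w \<circ> ?t)" by (rule top_rows_swap[OF w i1 i(2)]) (use i in simp)
      show "\<beta> j = code n (w \<circ> ?t) j"
        unfolding that \<alpha> by (rule code_swap_other[symmetric]) (use i j in auto)
    qed (fact j)+
    have asc: "raise n j w i < raise n j w (i + 1)"
      using raise_less_iff[OF inj, of i j "i + 1" n] i by simp
    have "schubert n w \<alpha> = dd i (schubert n (w \<circ> ?t)) \<alpha>"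
      by (simp only: schubert_ascent[OF p i1 i(2,3)])
    also have "\<dots> = dd i (schubert n (raise n j w \<circ> ?t)) (\<alpha>(j := n - j))"
    proof -
      have eq: "(\<alpha>(j := n - j)) i = \<alpha> i" "(\<alpha>(j := n - j)) (i + 1) = \<alpha> (i + 1)"
        using i by auto
      have upd: "(\<alpha>(i := x, i + 1 := y))(j := n - j) = (\<alpha>(j := n - j))(i := x, i + 1 := y)" for x y
        using i by (auto simp: fun_eq_iff)
      have "schubert n (w \<circ> ?t) (\<alpha>(i := x, i + 1 := y)) =
          schubert n (raise n j w \<circ> ?t) ((\<alpha>(j := n - j))(i := x, i + 1 := y))" for x y
        unfolding upd[symmetric] by (rule IH) (use i in simp)
      then show ?thesis unfolding dd_def eq by (simp only:)
    qed
    also have "\<dots> = schubert n (raise n j w) (\<alpha>(j := n - j))"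
      by (simp only: schubert_ascent[OF rp i1 i(2) asc])
    finally show ?thesis .
  next
    case False
    have desc: "w (i + 1) < w i" if "j < i" "i < n" for i
    proof -
      have "w i \<noteq> w (i + 1)" using inj by (metis injD less_add_one less_irrefl)
      with False that show ?thesis by (metis linorder_neqE_nat)
    qed
    have "raise n j w = longest_perm n"
    proof (rule top_rows_longest[OF r])
      fix k assume k: "1 \<le> k" "j + 1 \<le> k" "k < n"
      show "raise n j w (k + 1) < raise n j w k"
        using raise_less_iff[OF inj, of "k + 1" j k n] desc[of k] k by simp
    qed
    note r0 = this
    show ?thesis
    proof (cases "j < n \<and> w j < w (j + 1)")
      case False
      have "w (j + 1) < w j" if "j < n"
      proof -
        have "w j \<noteq> w (j + 1)" using inj by (metis injD less_add_one less_irrefl)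
        with False that show ?thesis by auto
      qed
      with desc have "w (k + 1) < w k" if "j \<le> k" "k < n" for k
        using that by (cases "k = j") auto
      then have w0: "w = longest_perm n" by (intro top_rows_longest[OF w])
      have "\<alpha> j = n - j" unfolding \<alpha> w0 by (rule code_longest) (use j in auto)
      then have "\<alpha>(j := n - j) = \<alpha>" by auto
      then show ?thesis unfolding r0 unfolding w0 by (simp only:)
    next
      case True
      then have jn: "j < n" and asc: "w j < w (j + 1)" by auto
      let ?t = "Transposition.transpose j (j + 1)"
      let ?w = "w \<circ> ?t"
      \<comment> \<open>The largest remaining value is at j or at j + 1, because the rows behind j
        decrease; the ascent rules out j.\<close>
      have wj: "w (j + 1) = n + 1 - j"
      proof -
        have "n + 1 - j \<in> w ` {1..n}" using permutes_image[OF p] j by auto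
        then obtain m where m: "m \<in> {1..n}" "w m = n + 1 - j" by auto
        have "j \<le> m"
        proof (rule ccontr)
          assume "\<not> j \<le> m"
          then have "w m = n + 1 - m" using w m by (auto simp: top_rows_def)
          with m \<open>\<not> j \<le> m\<close> show False by auto
        qed
        have "m = j + 1"
        proof (rule ccontr)
          assume "m \<noteq> j + 1"
          have "w m < w (j + 1)"
          proof (cases "m = j")
            case True
            with asc show ?thesis by simp
          next
            case False
            with \<open>m \<noteq> j + 1\<close> \<open>j \<le> m\<close> have "j + 1 < m" by simp
            show ?thesis
              by (rule decreasing_prefix[of "j + 1" n]) (use desc \<open>j + 1 < m\<close> m in auto)
          qed
          moreover have "w (j + 1) \<le> n + 1 - j" by (rule top_rows_le[OF w]) (use jn in auto)
          ultimately show False using m by simp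
        qed
        with m show ?thesis by simp
      qed
      have tw: "top_rows n (j + 1) ?w"
        by (rule top_rows_Suc[OF top_rows_swap[OF w j(1) jn]]) (use wj in auto)
      have pw: "?w permutes {1..n}" using tw by (simp add: top_rows_def)
      have codew: "code n ?w (j + 1) = \<alpha> j" unfolding \<alpha> by (rule code_swap_second[OF j(1) jn asc])
      have small: "\<alpha> j < n - j"
      proof -
        have "{l. j < l \<and> l \<le> n \<and> w l < w j} \<subseteq> {j + 1<..n}"
        proof
          fix l assume l: "l \<in> {l. j < l \<and> l \<le> n \<and> w l < w j}"
          with asc have "l \<noteq> j + 1" by auto
          with l show "l \<in> {j + 1<..n}" by auto
        qed
        then have "code n w j \<le> card {j + 1<..n}" unfolding code_def by (intro card_mono) auto
        with \<alpha> jn show ?thesis by simp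
      qed
      \<comment> \<open>In \<open>?w\<close> the rows up to j are top rows. Their code entries are
        all at least n - j, and only n - j positions follow j, so the exponent of x_j is
        fixed.\<close>
      have supp_j: "\<beta> j = n - j" if "schubert n ?w \<beta> \<noteq> 0" for \<beta>
      proof -
        have nz: "coeff_at (grothendieck n ?w) \<beta> \<noteq> 0" by (rule schubert_nonzero[OF that])
        obtain l where "l \<in> {1..j}" "code n ?w l \<le> \<beta> j"
          using grothendieck_support_lower[OF pw nz, of j] j by auto
        moreover from this have "code n ?w l = n - l" by (intro top_rows_code[OF tw]) (use j in auto)
        moreover have "\<beta> j \<le> card (nonrecords n ?w j)"
          by (rule grothendieck_support_upper[OF pw nz j(1)])
        moreover have "card (nonrecords n ?w j) \<le> card {j<..n}"
          by (rule card_mono) (auto simp: nonrecords_def)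
        ultimately show ?thesis by auto
      qed
      have supp_Suc: "\<alpha> j \<le> \<beta> (j + 1)" if "schubert n ?w \<beta> \<noteq> 0" for \<beta>
      proof -
        have nz: "coeff_at (grothendieck n ?w) \<beta> \<noteq> 0" by (rule schubert_nonzero[OF that])
        obtain l where l: "l \<in> {1..j + 1}" "code n ?w l \<le> \<beta> (j + 1)"
          using grothendieck_support_lower[OF pw nz, of "j + 1"] jn by auto
        show ?thesis
        proof (cases "l = j + 1")
          case True
          with l codew show ?thesis by simp
        next
          case False
          with l have "code n ?w l = n - l" by (intro top_rows_code[OF tw]) (use j in auto)
          with l False small show ?thesis by auto
        qed
      qed
      let ?\<beta> = "\<alpha>(j := \<alpha> (j + 1) + 1, j + 1 := \<alpha> j)"
      have "schubert n w \<alpha> = dd j (schubert n ?w) \<alpha>"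
        by (simp only: schubert_ascent[OF p j(1) jn asc])
      \<comment> \<open>The subtracted terms vanish by \<open>supp_j\<close>, since t \<le> \<alpha>
        j < n - j, and the others vanish for t < \<alpha> j by \<open>supp_Suc\<close>.\<close>
      also have "\<dots> = (\<Sum>t\<le>\<alpha> j. if t = \<alpha> j then schubert n ?w ?\<beta> else 0)"
        unfolding dd_def
      proof (rule sum.cong[OF refl])
        fix t assume "t \<in> {..\<alpha> j}"
        then have t: "t \<le> \<alpha> j" by simp
        have "schubert n ?w (\<alpha>(j := t, j + 1 := \<alpha> j + \<alpha> (j + 1) + 1 - t)) = 0"
          using supp_j[of "\<alpha>(j := t, j + 1 := \<alpha> j + \<alpha> (j + 1) + 1 - t)"] t small by fastforce
        moreover have "schubert n ?w (\<alpha>(j := \<alpha> j + \<alpha> (j + 1) + 1 - t, j + 1 := t)) = 0" if "t \<noteq> \<alpha> j"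
          using supp_Suc[of "\<alpha>(j := \<alpha> j + \<alpha> (j + 1) + 1 - t, j + 1 := t)"] t that by fastforce
        moreover have "\<alpha>(j := \<alpha> j + \<alpha> (j + 1) + 1 - \<alpha> j, j + 1 := \<alpha> j) = ?\<beta>" by simp
        ultimately show "schubert n ?w (\<alpha>(j := \<alpha> j + \<alpha> (j + 1) + 1 - t, j + 1 := t)) -
            schubert n ?w (\<alpha>(j := t, j + 1 := \<alpha> j + \<alpha> (j + 1) + 1 - t)) =
          (if t = \<alpha> j then schubert n ?w ?\<beta> else 0)"
          by (cases "t = \<alpha> j") (simp_all only: simp_thms if_True if_False diff_zero)
      qed
      also have "\<dots> = schubert n ?w ?\<beta>" by simp
      \<comment> \<open>The induction hypothesis is used at row j + 1: the value w j now sits there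
        with code \<alpha> j, so the exponent is again minimal.\<close>
      also have "\<dots> = schubert n (raise n (j + 1) ?w) (?\<beta>(j + 1 := n - (j + 1)))"
      proof (rule less.hyps)
        show "card (noninversions n ?w) < card (noninversions n w)"
          by (rule card_noninversions_less[OF j(1) jn asc])
        show "?\<beta> (j + 1) = code n ?w (j + 1)" unfolding codew by simp
      qed (use tw jn in auto)
      also have "raise n (j + 1) ?w = longest_perm n"
      proof (rule top_rows_longest[OF raise_top_rows[OF tw]])
        fix k assume k: "1 \<le> k" "j + 1 + 1 \<le> k" "k < n"
        have "raise n (j + 1) ?w (k + 1) < raise n (j + 1) ?w k \<longleftrightarrow> ?w (k + 1) < ?w k"
          by (rule raise_less_iff[OF permutes_inj[OF pw]]) (use k in auto)
        also have "?w (k + 1) < ?w k" using desc[of k] k by simp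
        finally show "raise n (j + 1) ?w (k + 1) < raise n (j + 1) ?w k" by simp
      qed (use jn in auto)
      also have "?\<beta>(j + 1 := n - (j + 1)) = \<alpha>(j := \<alpha> (j + 1) + 1, j + 1 := n - (j + 1))" by simp
      also have "schubert n (longest_perm n) \<dots> = schubert n (longest_perm n) (\<alpha>(j := n - j))"
      proof -
        let ?\<delta> = "\<lambda>k. if k \<in> {1..n} then n - k else 0"
        \<comment> \<open>The left side demands \<alpha> (j + 1) + 1 = n - j at position j, the
          right side \<alpha> (j + 1) = n - (j + 1) at position j + 1; these are the same
          condition.\<close>
        have "\<alpha>(j := \<alpha> (j + 1) + 1, j + 1 := n - (j + 1)) = ?\<delta> \<longleftrightarrow> \<alpha>(j := n - j) = ?\<delta>"
        proof
          assume *: "\<alpha>(j := \<alpha> (j + 1) + 1, j + 1 := n - (j + 1)) = ?\<delta>"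
          have a: "\<alpha> (j + 1) = n - (j + 1)" using fun_cong[OF *, of j] j jn by auto
          have rest: "\<alpha> k = ?\<delta> k" if "k \<noteq> j" "k \<noteq> j + 1" for k
            using fun_cong[OF *, of k] that by simp
          show "\<alpha>(j := n - j) = ?\<delta>"
          proof
            fix k
            show "(\<alpha>(j := n - j)) k = ?\<delta> k"
              using a rest[of k] j jn by (cases "k = j"; cases "k = j + 1") simp_all
          qed
        next
          assume *: "\<alpha>(j := n - j) = ?\<delta>"
          have a: "\<alpha> (j + 1) = n - (j + 1)" using fun_cong[OF *, of "j + 1"] j jn by auto
          have rest: "\<alpha> k = ?\<delta> k" if "k \<noteq> j" for k
            using fun_cong[OF *, of k] that by simp
          show "\<alpha>(j := \<alpha> (j + 1) + 1, j + 1 := n - (j + 1)) = ?\<delta>"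
          proof
            fix k
            show "(\<alpha>(j := \<alpha> (j + 1) + 1, j + 1 := n - (j + 1))) k = ?\<delta> k"
              using a rest[of k] j jn by (cases "k = j"; cases "k = j + 1") simp_all
          qed
        qed
        then show ?thesis unfolding schubert_longest by (simp only:)
      qed
      finally show ?thesis unfolding r0 .
    qed
  qed
qed

section \<open>Maximal slices of Schubert polynomials\<close>

text \<open>
  Rotates the left-to-right maxima of \<open>w j, \<dots>, w n\<close>: the last one moves to the front, and every
  other one to the position of its successor.
\<close>

definition rotate_records :: "nat \<Rightarrow> nat \<Rightarrow> (nat \<Rightarrow> nat) \<Rightarrow> nat \<Rightarrow> nat"
  where "rotate_records n j w k =
    (if k = j then n + 1 - j
     else if j < k \<and> k \<le> n then min (w k) (Max (w ` {j..<k}))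
     else w k)"

lemma rotate_records_top_rows:
  assumes w: "top_rows n j w" and j: "1 \<le> j" "j \<le> n"
  shows "top_rows n (j + 1) (rotate_records n j w)"
proof -
  let ?v = "rotate_records n j w"
  have p: "w permutes {1..n}" using w by (simp add: top_rows_def)
  then have inj: "inj w" by (rule permutes_inj)
  have w_in: "w k \<in> {1..n}" if "k \<in> {1..n}" for k using permutes_in_image[OF p, of k] that by simp
  define M where "M k = Max (w ` {j..<k})" for k
  have M_in: "\<exists>l. j \<le> l \<and> l < k \<and> M k = w l" if "j < k" for k
  proof -
    have "M k \<in> w ` {j..<k}" unfolding M_def by (rule Max_in) (use that in auto)
    then show ?thesis by auto
  qed
  have M_ge: "w l \<le> M k" if "j \<le> l" "l < k" for l k
    unfolding M_def by (rule Max_ge) (use that in auto)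
  have tail: "?v k = min (w k) (M k)" if "j < k" "k \<le> n" for k
    using that by (simp add: rotate_records_def M_def)
  have before: "?v k = w k" if "k < j" for k using that by (simp add: rotate_records_def)
  have top: "w k = n + 1 - k" if "k \<in> {1..<j}" for k using w that by (simp add: top_rows_def)
  have at: "?v j = n + 1 - j" by (simp add: rotate_records_def)
  have tail_in: "\<exists>l. j \<le> l \<and> l \<le> k \<and> ?v k = w l" if "j < k" "k \<le> n" for k
  proof (cases "w k \<le> M k")
    case True
    then show ?thesis using tail[OF that] that by (intro exI[of _ k]) auto
  next
    case False
    then show ?thesis using M_in[OF that(1)] tail[OF that] by (auto simp: min_def)
  qed
  have tail_less: "?v k < n + 1 - j" if k: "j < k" "k \<le> n" for k
  proof -
    obtain l where l: "j \<le> l" "l < k" "M k = w l" using M_in[OF k(1)] by blast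
    have "w k \<noteq> w l" using inj l by (metis injD less_irrefl)
    moreover have "w k \<le> n + 1 - j" "w l \<le> n + 1 - j"
      using top_rows_le[OF w] k l by auto
    ultimately show ?thesis using tail[OF k] l by auto
  qed
  \<comment> \<open>The running maximum at l is at least both of the distinct numbers
    \<open>w k\<close> and \<open>M k\<close>, so it exceeds their minimum \<open>?v k\<close>.
    Equality would make \<open>?v l\<close> the value w l itself, whereas \<open>?v k\<close> is a
    value from a position up to k.\<close>
  have tail_neq: "?v k \<noteq> ?v l" if k: "j < k" "k < l" "l \<le> n" for k l
  proof
    assume eq: "?v k = ?v l"
    have k': "j < k" "k \<le> n" and l': "j < l" "l \<le> n" using k by auto
    obtain a where a: "j \<le> a" "a \<le> k" "?v k = w a" using tail_in[OF k'] by blast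
    obtain b where b: "j \<le> b" "b < k" "M k = w b" using M_in[OF k'(1)] by blast
    have "w k \<noteq> w b" using inj b by (metis injD less_irrefl)
    then have "?v k < w k \<or> ?v k < w b" using tail[OF k'] b by auto
    moreover have "w k \<le> M l" "w b \<le> M l" using M_ge k b by auto
    ultimately have "?v l < M l" using eq by auto
    then have "?v l = w l" using tail[OF l'] by (auto simp: min_def split: if_splits)
    then have "a = l" using eq a inj by (metis injD)
    with a k show False by simp
  qed
  have neq: "?v k \<noteq> ?v l" if "k \<in> {1..n}" "l \<in> {1..n}" "k < l" for k l
  proof -
    have "l < j \<or> k < j \<and> l = j \<or> k < j \<and> j < l \<or> k = j \<and> j < l \<or> j < k"
      using that(3) by linarith
    then consider "l < j" | "k < j" "l = j" | "k < j" "j < l" | "k = j" "j < l" | "j < k" by blast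
    then show ?thesis
    proof cases
      case 1
      then show ?thesis using before top that by auto
    next
      case 2
      then show ?thesis using before[of k] top[of k] at that j by auto
    next
      case 3
      then show ?thesis using before[of k] top[of k] tail_less[of l] that by auto
    next
      case 4
      then show ?thesis using at tail_less[of l] that by auto
    next
      case 5
      then show ?thesis using tail_neq[of k l] that by auto
    qed
  qed
  have "inj_on ?v {1..n}"
  proof (rule inj_onI)
    fix k l assume "k \<in> {1..n}" "l \<in> {1..n}" "?v k = ?v l"
    then show "k = l" using neq[of k l] neq[of l k] by (cases k l rule: linorder_cases) auto
  qed
  moreover have "?v ` {1..n} \<subseteq> {1..n}"
  proof (rule image_subsetI)
    fix k assume k: "k \<in> {1..n}"
    consider "k < j" | "k = j" | "j < k" by linarith
    then show "?v k \<in> {1..n}"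
    proof cases
      case 1
      then show ?thesis using before[of k] w_in[OF k] by simp
    next
      case 2
      then show ?thesis using at j by auto
    next
      case 3
      then obtain l where "j \<le> l" "l \<le> k" "?v k = w l" using tail_in[of k] k by auto
      then show ?thesis using w_in[of l] j k by auto
    qed
  qed
  ultimately have "bij_betw ?v {1..n} {1..n}"
    by (metis bij_betw_imageI endo_inj_surj finite_atLeastAtMost)
  moreover have "?v k = k" if "k \<notin> {1..n}" for k
    using that j permutes_not_in[OF p that] by (auto simp: rotate_records_def)
  ultimately have "?v permutes {1..n}" by (rule bij_imp_permutes)
  then show ?thesis using before top at by (auto simp: top_rows_def less_Suc_eq)
qed

text \<open>The two leading values enter only through their minimum, at i + 1, and through later
  running maxima; both are symmetric in them.\<close>

lemma rotate_records_swap_first: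
  assumes "1 \<le> i" "i < n" "w i < w (i + 1)"
  shows "rotate_records n i (w \<circ> Transposition.transpose i (i + 1)) = rotate_records n i w"
proof
  fix k
  let ?t = "Transposition.transpose i (i + 1)"
  consider "k \<le> i \<or> n < k" | "k = i + 1" "k \<le> n" | "i + 1 < k" "k \<le> n" by linarith
  then show "rotate_records n i (w \<circ> ?t) k = rotate_records n i w k"
  proof cases
    case 1
    with assms show ?thesis by (auto simp: rotate_records_def)
  next
    case 2
    have "{i..<i + 1} = {i}" by auto
    with 2 assms show ?thesis by (simp add: rotate_records_def)
  next
    case 3
    have "?t l \<in> {i..<k} \<longleftrightarrow> l \<in> {i..<k}" for l
      using adjacent_transpose_less_iff[of i i l] adjacent_transpose_less_iff[of k i l] 3 by auto
    then have "?t ` {i..<k} = {i..<k}" by (intro set_eqI) (simp only: in_transpose_image_iff)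
    then have "(w \<circ> ?t) ` {i..<k} = w ` {i..<k}" by (simp only: image_comp[symmetric])
    with 3 show ?thesis by (simp add: rotate_records_def)
  qed
qed

text \<open>The value w i lies below an earlier one, so it is a nonrecord before and after the swap
  and is left alone by the rotation. The running maximum M before i exceeds it, so the ascent
  survives even if w (i + 1) is replaced by M.\<close>

lemma rotate_records_swap_after:
  assumes "j < i" "i < n" "w i < w (i + 1)" "w i < w (i - 1)"
  shows "rotate_records n j (w \<circ> Transposition.transpose i (i + 1)) =
      rotate_records n j w \<circ> Transposition.transpose i (i + 1)"
    and "rotate_records n j w i < rotate_records n j w (i + 1)"
proof -
  let ?t = "Transposition.transpose i (i + 1)"
  define M where "M = Max (w ` {j..<i})"
  have Mi: "w i < M"
  proof -
    have "w (i - 1) \<le> M" unfolding M_def by (rule Max_ge) (use assms(1) in auto)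
    with assms(4) show ?thesis by simp
  qed
  have "{j..<i + 1} = insert i {j..<i}" using assms(1) by auto
  then have M': "Max (w ` {j..<i + 1}) = M"
    using Mi assms(1) by (simp add: M_def max_def)
  have "(w \<circ> ?t) ` {j..<i} = w ` {j..<i}" by (rule image_cong) auto
  then have N: "Max ((w \<circ> ?t) ` {j..<i}) = M" by (simp only: M_def)
  have "{j..<i + 1} = insert i {j..<i}" using assms(1) by auto
  then have N': "Max ((w \<circ> ?t) ` {j..<i + 1}) = max (w (i + 1)) M"
    using assms(1) by (simp only: image_insert N) (simp add: Max_insert N[simplified])
  have v: "rotate_records n j w i = w i" "rotate_records n j w (i + 1) = min (w (i + 1)) M"
    using assms(1,2) Mi M' M_def by (auto simp: rotate_records_def)
  show "rotate_records n j w i < rotate_records n j w (i + 1)" using v Mi assms(3) by simp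
  show "rotate_records n j (w \<circ> ?t) = rotate_records n j w \<circ> ?t"
  proof
    fix k
    consider "k = i" | "k = i + 1" | "k \<noteq> i" "k \<noteq> i + 1" by blast
    then show "rotate_records n j (w \<circ> ?t) k = (rotate_records n j w \<circ> ?t) k"
    proof cases
      case 1
      then have "rotate_records n j (w \<circ> ?t) k = min (w (i + 1)) M"
        using assms(1,2) N by (simp add: rotate_records_def)
      then show ?thesis using 1 v by simp
    next
      case 2
      then have "rotate_records n j (w \<circ> ?t) k = min (w i) (max (w (i + 1)) M)"
        using assms(1,2) N' by (simp add: rotate_records_def)
      also have "\<dots> = w i" using assms(3) by simp
      finally show ?thesis using 2 v by simp
    next
      case 3
      have "(w \<circ> ?t) ` {j..<k} = w ` {j..<k}"
      proof -
        have "?t l \<in> {j..<k} \<longleftrightarrow> l \<in> {j..<k}" if "j < k" for l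
          using adjacent_transpose_less_iff[of j i l] adjacent_transpose_less_iff[of k i l]
            3 assms(1) by auto
        then have "?t ` {j..<k} = {j..<k}"
          by (cases "j < k") (intro set_eqI, simp only: in_transpose_image_iff, simp)
        then show ?thesis by (simp only: image_comp[symmetric])
      qed
      with 3 show ?thesis unfolding rotate_records_def by simp
    qed
  qed
qed

section \<open>Symmetry of the coefficients at an ascent\<close>

lemma grothendieck_swap:
  assumes "w permutes {1..n}" "1 \<le> i" "i < n" "w i < w (i + 1)"
  shows "coeff_at (grothendieck n w) (\<beta> \<circ> Transposition.transpose i (i + 1)) =
    coeff_at (grothendieck n w) \<beta>"
  unfolding grothendieck_ascent[OF assms] by (rule coeff_at_divided_difference_swap)

lemma schubert_swap:
  assumes "w permutes {1..n}" "1 \<le> i" "i < n" "w i < w (i + 1)"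
  shows "schubert n w (\<beta> \<circ> Transposition.transpose i (i + 1)) = schubert n w \<beta>"
proof -
  let ?t = "Transposition.transpose i (i + 1)"
  have "?t permutes {1..n}" by (rule permutes_swap_id) (use assms in auto)
  then have "sum (\<beta> \<circ> ?t) {1..n} = sum \<beta> {1..n}" by (rule sum.permute[symmetric])
  then show ?thesis unfolding schubert_def grothendieck_swap[OF assms] by (simp only:)
qed

text \<open>
  Recursing along the first ascent keeps the maximal power of $x_j$ in sight: if the ascent is at
  \<open>j\<close>, the divided difference turns $x_j^{u+1}$ into $x_j^u$ without further contributions, and if
  it comes later, the divided difference acts on the other variables only.
\<close>

lemma schubert_max_slice:
  assumes "w permutes {1..n}" "top_rows n j w" "1 \<le> j" "j \<le> n" "\<alpha> j = card (nonrecords n w j)"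
  shows "schubert n w \<alpha> = schubert n (rotate_records n j w) (\<alpha>(j := n - j))"
  using assms
proof (induction arbitrary: \<alpha> rule: first_ascent_induct)
  case longest
  have "rotate_records n j (longest_perm n) = longest_perm n"
  proof
    fix k
    have "longest_perm n k \<le> Max (longest_perm n ` {j..<k})" if "j < k" "k \<le> n"
    proof (rule order_trans)
      show "longest_perm n k \<le> longest_perm n j" using that longest(2) by (auto simp: longest_perm_def)
      show "longest_perm n j \<le> Max (longest_perm n ` {j..<k})" by (rule Max_ge) (use that in auto)
    qed
    moreover have "longest_perm n j = n + 1 - j" using longest(2,3) by (simp add: longest_perm_def)
    ultimately show "rotate_records n j (longest_perm n) k = longest_perm n k"
      by (simp add: rotate_records_def)
  qed
  moreover have "\<alpha>(j := n - j) = \<alpha>"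
    using longest by (auto simp: nonrecords_longest)
  ultimately show ?case by simp
next
  case (ascent w i)
  let ?t = "Transposition.transpose i (i + 1)"
  note i = ascent(2-4) and w = ascent(7) and j = ascent(8,9) and \<alpha> = ascent(10)
  have v: "rotate_records n j w permutes {1..n}"
    using rotate_records_top_rows[OF w j] by (simp add: top_rows_def)
  have ji: "j \<le> i"
  proof (rule ccontr)
    assume "\<not> j \<le> i"
    then have "top_rows n (i + 1) w" using w by (auto simp: top_rows_def)
    then have "w (i + 1) \<le> n + 1 - (i + 1)" by (rule top_rows_le) (use i in auto)
    moreover have "w i = n + 1 - i" using w i \<open>\<not> j \<le> i\<close> by (auto simp: top_rows_def)
    ultimately show False using i by simp
  qed
  have tw: "top_rows n j (w \<circ> ?t)" by (rule top_rows_swap[OF w i(1,2) ji])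
  have pw: "w \<circ> ?t permutes {1..n}" by (rule permutes_swap[OF ascent(1) i(1,2)])
  show ?case
  proof (cases "j = i")
    case True
    have max_i: "\<beta> i \<le> \<alpha> i + 1" "\<beta> (i + 1) \<le> \<alpha> i" if "schubert n (w \<circ> ?t) \<beta> \<noteq> 0" for \<beta>
    proof -
      have nz: "coeff_at (grothendieck n (w \<circ> ?t)) \<beta> \<noteq> 0" by (rule schubert_nonzero[OF that])
      have "\<alpha> i = card (nonrecords n w i)" using \<alpha> True by simp
      moreover have "\<beta> i \<le> card (nonrecords n w i) + 1"
        using grothendieck_support_upper[OF pw nz i(1)] by (simp only: card_nonrecords_swap_first[OF i])
      moreover have "\<beta> (i + 1) \<le> card (nonrecords n w i)"
        using grothendieck_support_upper[OF pw nz, of "i + 1"] by (rule order_trans)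
          (simp_all only: le_add2 card_mono[OF finite_nonrecords nonrecords_swap_second[OF i(3)]])
      ultimately show "\<beta> i \<le> \<alpha> i + 1" "\<beta> (i + 1) \<le> \<alpha> i" by simp_all
    qed
    let ?F = "schubert n (w \<circ> ?t)" and ?\<alpha> = "\<alpha>(i := \<alpha> i + 1)"
    have upd: "(\<alpha> \<circ> ?t)(i := x, i + 1 := y) = \<alpha>(i := x, i + 1 := y)" for x y
      by (auto simp: fun_eq_iff Transposition.transpose_def)
    \<comment> \<open>Passing to the swapped exponents truncates the sum in \<open>dd\<close> at
      \<alpha> (i + 1) instead of \<alpha> i. In that range the subtracted terms have an exponent of
      x_{i+1} above \<alpha> i, and the others have an exponent of x_i above \<alpha> i + 1 unless t
      = \<alpha> (i + 1).\<close>
    have "schubert n w \<alpha> = schubert n w (\<alpha> \<circ> ?t)"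
      by (simp only: schubert_swap[OF ascent(1) i])
    also have "\<dots> = dd i ?F (\<alpha> \<circ> ?t)"
      by (simp only: schubert_ascent[OF ascent(1) i])
    also have "\<dots> = (\<Sum>t\<le>\<alpha> (i + 1). ?F (\<alpha>(i := \<alpha> (i + 1) + \<alpha> i + 1 - t, i + 1 := t)) -
        ?F (\<alpha>(i := t, i + 1 := \<alpha> (i + 1) + \<alpha> i + 1 - t)))"
      by (simp only: dd_def upd o_apply[of \<alpha>] transpose_apply_first transpose_apply_second)
    also have "\<dots> = (\<Sum>t\<le>\<alpha> (i + 1). if t = \<alpha> (i + 1) then ?F ?\<alpha> else 0)"
    proof (rule sum.cong[OF refl])
      fix t assume "t \<in> {..\<alpha> (i + 1)}"
      then have t: "t \<le> \<alpha> (i + 1)" by simp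
      let ?D = "\<alpha> (i + 1) + \<alpha> i + 1"
      have "?F (\<alpha>(i := t, i + 1 := ?D - t)) = 0"
        using max_i(2)[of "\<alpha>(i := t, i + 1 := ?D - t)"] t by fastforce
      moreover have "?F (\<alpha>(i := ?D - t, i + 1 := t)) = 0" if "t \<noteq> \<alpha> (i + 1)"
        using max_i(1)[of "\<alpha>(i := ?D - t, i + 1 := t)"] t that by fastforce
      moreover have "\<alpha>(i := ?D - \<alpha> (i + 1), i + 1 := \<alpha> (i + 1)) = ?\<alpha>"
        by (auto simp: fun_eq_iff)
      ultimately show "?F (\<alpha>(i := ?D - t, i + 1 := t)) - ?F (\<alpha>(i := t, i + 1 := ?D - t)) =
          (if t = \<alpha> (i + 1) then ?F ?\<alpha> else 0)"
        by (cases "t = \<alpha> (i + 1)") (simp_all only: simp_thms if_True if_False diff_zero)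
    qed
    also have "\<dots> = ?F ?\<alpha>" by simp
    also have "\<dots> = schubert n (rotate_records n j (w \<circ> ?t)) (?\<alpha>(j := n - j))"
    proof (rule ascent.IH[OF tw j])
      show "?\<alpha> j = card (nonrecords n (w \<circ> ?t) j)"
        using \<alpha> True by (simp only: card_nonrecords_swap_first[OF i] fun_upd_same)
    qed
    also have "\<dots> = schubert n (rotate_records n j w) (\<alpha>(j := n - j))"
      unfolding True rotate_records_swap_first[OF i] fun_upd_upd ..
    finally show ?thesis .
  next
    case False
    with ji have ij: "j < i" by simp
    then have d: "w i < w (i - 1)" using ascent(5)[of "i - 1"] j by simp
    note rot = rotate_records_swap_after[OF ij i(2,3) d]
    have IH: "schubert n (w \<circ> ?t) \<beta> = schubert n (rotate_records n j w \<circ> ?t) (\<beta>(j := n - j))"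
      if "\<beta> j = \<alpha> j" for \<beta>
      unfolding rot(1)[symmetric]
    proof (rule ascent.IH[OF tw j])
      show "\<beta> j = card (nonrecords n (w \<circ> ?t) j)"
        unfolding that \<alpha> by (rule card_nonrecords_swap_before[OF i(2,3) j(1) ij d, symmetric])
    qed
    have "schubert n w \<alpha> = dd i (schubert n (w \<circ> ?t)) \<alpha>"
      by (simp only: schubert_ascent[OF ascent(1) i])
    also have "\<dots> = dd i (schubert n (rotate_records n j w \<circ> ?t)) (\<alpha>(j := n - j))"
    proof -
      have eq: "(\<alpha>(j := n - j)) i = \<alpha> i" "(\<alpha>(j := n - j)) (i + 1) = \<alpha> (i + 1)"
        using ij by auto
      have upd: "(\<alpha>(i := x, i + 1 := y))(j := n - j) = (\<alpha>(j := n - j))(i := x, i + 1 := y)" for x y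
        using ij by (auto simp: fun_eq_iff)
      have "schubert n (w \<circ> ?t) (\<alpha>(i := x, i + 1 := y)) =
          schubert n (rotate_records n j w \<circ> ?t) ((\<alpha>(j := n - j))(i := x, i + 1 := y))" for x y
        unfolding upd[symmetric] by (rule IH) (use ij in simp)
      then show ?thesis unfolding dd_def eq by (simp only:)
    qed
    also have "\<dots> = schubert n (rotate_records n j w) (\<alpha>(j := n - j))"
      by (simp only: schubert_ascent[OF v i(1,2) rot(2)])
    finally show ?thesis .
  qed
qed

section \<open>Extremal monomials from iterated slices\<close>

lemma code_cong:
  assumes "\<And>l. k < l \<Longrightarrow> l \<le> n \<Longrightarrow> u l < u k \<longleftrightarrow> w l < w k"
  shows "code n u k = code n w k"
  unfolding code_def by (rule arg_cong[where f = card], rule Collect_cong) (use assms in auto)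

lemma nonrecords_cong:
  assumes "\<And>k l. j \<le> k \<Longrightarrow> k \<le> n \<Longrightarrow> j \<le> l \<Longrightarrow> l \<le> n \<Longrightarrow> u k < u l \<longleftrightarrow> w k < w l"
  shows "nonrecords n u j = nonrecords n w j"
proof (intro equalityI subsetI)
  fix l assume "l \<in> nonrecords n u j"
  then obtain k where k: "j < l" "l \<le> n" "j \<le> k" "k < l" "u l < u k" by (rule nonrecordsE)
  then show "l \<in> nonrecords n w j" using assms[of l k] by (intro nonrecordsI[of _ _ _ k]) auto
next
  fix l assume "l \<in> nonrecords n w j"
  then obtain k where k: "j < l" "l \<le> n" "j \<le> k" "k < l" "w l < w k" by (rule nonrecordsE)
  then show "l \<in> nonrecords n u j" using assms[of l k] by (intro nonrecordsI[of _ _ _ k]) auto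
qed

text \<open>Iterates the minimal slice over the rows 1, ..., j. Only the relative order of the
  remaining rows is recorded about u, since their codes and nonrecords depend on nothing
  else.\<close>

lemma schubert_delete_rows:
  assumes "w permutes {1..n}" "j < n"
  shows "\<exists>u. top_rows n (j + 1) u \<and>
    (\<forall>k l. j < k \<longrightarrow> k \<le> n \<longrightarrow> j < l \<longrightarrow> l \<le> n \<longrightarrow> (u k < u l \<longleftrightarrow> w k < w l)) \<and>
    (\<forall>\<alpha>. (\<forall>k\<in>{1..j}. \<alpha> k = code n w k) \<longrightarrow>
      schubert n w \<alpha> = schubert n u (\<lambda>k. if k \<in> {1..j} then n - k else \<alpha> k))"
  using assms(2)
proof (induction j)
  case 0
  then show ?case using assms(1) by (intro exI[of _ w]) (simp add: top_rows_def)
next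
  case (Suc j)
  from Suc.IH[OF Suc_lessD[OF Suc.prems]]
  obtain u where u: "top_rows n (j + 1) u"
    "\<forall>k l. j < k \<longrightarrow> k \<le> n \<longrightarrow> j < l \<longrightarrow> l \<le> n \<longrightarrow> (u k < u l \<longleftrightarrow> w k < w l)"
    "\<forall>\<alpha>. (\<forall>k\<in>{1..j}. \<alpha> k = code n w k) \<longrightarrow>
      schubert n w \<alpha> = schubert n u (\<lambda>k. if k \<in> {1..j} then n - k else \<alpha> k)"
    by (elim exE conjE)
  have inj: "inj u" using u(1) permutes_inj by (auto simp: top_rows_def)
  show ?case
  proof (intro exI[of _ "raise n (j + 1) u"] conjI allI impI)
    show "top_rows n (Suc j + 1) (raise n (j + 1) u)"
      using raise_top_rows[OF u(1)] Suc.prems by simp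
  next
    fix k l assume kl: "Suc j < k" "k \<le> n" "Suc j < l" "l \<le> n"
    have "raise n (j + 1) u k < raise n (j + 1) u l \<longleftrightarrow> u k < u l"
      by (rule raise_less_iff[OF inj]) (use kl in auto)
    also have "\<dots> \<longleftrightarrow> w k < w l" by (rule u(2)[rule_format]) (use kl in auto)
    finally show "raise n (j + 1) u k < raise n (j + 1) u l \<longleftrightarrow> w k < w l" .
  next
    fix \<alpha> assume \<alpha>: "\<forall>k\<in>{1..Suc j}. \<alpha> k = code n w k"
    let ?\<beta> = "\<lambda>k. if k \<in> {1..j} then n - k else \<alpha> k"
    have "schubert n w \<alpha> = schubert n u ?\<beta>" by (rule u(3)[rule_format]) (use \<alpha> in auto)
    also have "\<dots> = schubert n (raise n (j + 1) u) (?\<beta>(j + 1 := n - (j + 1)))"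
    proof (rule schubert_min_slice[OF u(1)])
      have "code n u (j + 1) = code n w (j + 1)"
        by (rule code_cong) (use u(2) Suc.prems in auto)
      with \<alpha> show "?\<beta> (j + 1) = code n u (j + 1)" by auto
    qed (use Suc.prems in auto)
    also have "?\<beta>(j + 1 := n - (j + 1)) = (\<lambda>k. if k \<in> {1..Suc j} then n - k else \<alpha> k)"
      by (auto simp: fun_eq_iff le_Suc_eq)
    finally show "schubert n w \<alpha> = schubert n (raise n (j + 1) u)
        (\<lambda>k. if k \<in> {1..Suc j} then n - k else \<alpha> k)" .
  qed
qed

lemma code_outside:
  assumes "w permutes {1..n}" "k \<notin> {1..<n}"
  shows "code n w k = 0"
proof -
  have "w 0 = 0" by (rule permutes_not_in[OF assms(1)]) simp
  then have "{l. k < l \<and> l \<le> n \<and> w l < w k} = {}" using assms(2) by (cases "k = 0") auto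
  then show ?thesis by (simp add: code_def)
qed

text \<open>Taking the minimal power in each of the rows 1, ..., n - 1 leaves one value for the last
  row, hence the longest permutation. The coefficient is in fact 1.\<close>

lemma schubert_code_nonzero:
  assumes w: "w permutes {1..n}" and n: "0 < n"
  shows "schubert n w (code n w) \<noteq> 0"
proof -
  obtain m where m: "n = Suc m" using n by (cases n) auto
  obtain u where u: "top_rows n (m + 1) u"
    "\<And>\<alpha>. (\<forall>k\<in>{1..m}. \<alpha> k = code n w k) \<Longrightarrow>
      schubert n w \<alpha> = schubert n u (\<lambda>k. if k \<in> {1..m} then n - k else \<alpha> k)"
  proof -
    have "m < n" using m by simp
    from schubert_delete_rows[OF w this] show thesis by (elim exE conjE) (rule that, assumption, blast)
  qed
  have "u = longest_perm n" by (rule top_rows_longest[OF u(1)]) (use m in auto)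
  moreover have "(\<lambda>k. if k \<in> {1..m} then n - k else code n w k) = (\<lambda>k. if k \<in> {1..n} then n - k else 0)"
    using code_outside[OF w] m by (auto simp: fun_eq_iff)
  ultimately show ?thesis using u(2)[of "code n w"] by (simp add: schubert_longest)
qed

lemma grothendieck_support_extremal:
  assumes w: "w permutes {1..n}" and j: "1 \<le> j" "j \<le> n"
  obtains \<alpha> where "coeff_at (grothendieck n w) \<alpha> \<noteq> 0" "\<And>k. k \<in> {1..<j} \<Longrightarrow> \<alpha> k = code n w k"
    "\<alpha> j = card (nonrecords n w j)"
proof -
  obtain i where i: "j = Suc i" using j by (cases j) auto
  from i j have "i < n" by simp
  from schubert_delete_rows[OF w this]
  obtain u where u: "top_rows n j u"
    "\<forall>k l. i < k \<longrightarrow> k \<le> n \<longrightarrow> i < l \<longrightarrow> l \<le> n \<longrightarrow> (u k < u l \<longleftrightarrow> w k < w l)"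
    "\<forall>\<alpha>. (\<forall>k\<in>{1..i}. \<alpha> k = code n w k) \<longrightarrow>
      schubert n w \<alpha> = schubert n u (\<lambda>k. if k \<in> {1..i} then n - k else \<alpha> k)"
    unfolding i Suc_eq_plus1 by (elim exE conjE)
  define v where "v = rotate_records n j u"
  have v: "top_rows n (j + 1) v" unfolding v_def by (rule rotate_records_top_rows[OF u(1) j])
  \<comment> \<open>Behind j any monomial of the remaining Schubert polynomial would serve; the code
    of \<open>v\<close> gives one that is known to occur.\<close>
  define \<alpha> where "\<alpha> k = (if k \<in> {1..i} then code n w k
    else if k = j then card (nonrecords n w j) else code n v k)" for k
  let ?\<beta> = "\<lambda>k. if k \<in> {1..i} then n - k else \<alpha> k"
  have "schubert n w \<alpha> = schubert n u ?\<beta>" by (rule u(3)[rule_format]) (simp add: \<alpha>_def)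
  also have "\<dots> = schubert n v (?\<beta>(j := n - j))"
    unfolding v_def
  proof (rule schubert_max_slice[OF _ u(1) j])
    show "u permutes {1..n}" using u(1) by (simp add: top_rows_def)
    have "nonrecords n u j = nonrecords n w j" by (rule nonrecords_cong) (use u(2) i in auto)
    then show "?\<beta> j = card (nonrecords n u j)" using i by (simp add: \<alpha>_def)
  qed
  \<comment> \<open>The rows of \<open>v\<close> up to j are top rows, whose code entries are the
    exponents n - k put in there.\<close>
  also have "?\<beta>(j := n - j) = code n v"
  proof
    fix k
    show "(?\<beta>(j := n - j)) k = code n v k"
      using top_rows_code[OF v, of k] i j by (auto simp: \<alpha>_def)
  qed
  also have "schubert n v (code n v) \<noteq> 0"
    by (rule schubert_code_nonzero) (use v j in \<open>auto simp: top_rows_def\<close>)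
  finally have "coeff_at (grothendieck n w) \<alpha> \<noteq> 0" by (rule schubert_nonzero)
  then show thesis by (rule that) (use i in \<open>auto simp: \<alpha>_def\<close>)
qed

section \<open>Patterns\<close>

text \<open>q_k of the overview counts these positions.\<close>

definition large_nonrecords :: "nat \<Rightarrow> (nat \<Rightarrow> nat) \<Rightarrow> nat \<Rightarrow> nat set"
  where "large_nonrecords n w k =
    {l. l \<le> n \<and> w k < w l \<and> (\<exists>s. k < s \<and> s < l \<and> w l < w s)}"

lemma finite_large_nonrecords [simp]: "finite (large_nonrecords n w k)"
  by (rule finite_subset[of _ "{..n}"]) (auto simp: large_nonrecords_def)

text \<open>Comparing consecutive values suffices, as the other comparisons follow by transitivity.
  The index pairs in the proof list the places of 1 and 2, of 2 and 3, and of 3 and 4 in the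
  pattern; the two lemmas after this one follow the same scheme.\<close>

lemma contains_1432_iff:
  "contains_pattern n w [1, 4, 3, 2] \<longleftrightarrow> (\<exists>a b c d. 1 \<le> a \<and> a < b \<and> b < c \<and> c < d \<and> d \<le> n \<and>
    w a < w d \<and> w d < w c \<and> w c < w b)" (is "?L \<longleftrightarrow> ?R")
proof
  assume ?L
  then obtain "is" where idx: "length is = Suc (Suc (Suc (Suc 0)))" "sorted_wrt (<) is" "set is \<subseteq> {1..n}"
    "\<forall>a<4. \<forall>b<4. w (is ! a) < w (is ! b) \<longleftrightarrow> [1, 4, 3, 2::nat] ! a < [1, 4, 3, 2] ! b"
    unfolding contains_pattern_def by auto
  from idx(1) obtain a b c d where "is = [a, b, c, d]" by (auto simp: length_Suc_conv)
  moreover from this idx(2,3) have "1 \<le> a" "a < b" "b < c" "c < d" "d \<le> n" by auto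
  ultimately have "1 \<le> a \<and> a < b \<and> b < c \<and> c < d \<and> d \<le> n \<and>
      w a < w d \<and> w d < w c \<and> w c < w b"
    using idx(4)[rule_format, of 0 3]
      idx(4)[rule_format, of 3 2]
      idx(4)[rule_format, of 2 1]
    by simp
  then show ?R by blast
next
  assume ?R
  then obtain a b c d where "1 \<le> a" "a < b" "b < c" "c < d" "d \<le> n" "w a < w d" "w d < w c" "w c < w b"
    by blast
  then show ?L unfolding contains_pattern_def
    by (intro exI[of _ "[a, b, c, d]"]) (auto simp: All_less_Suc)
qed

lemma contains_1423_iff:
  "contains_pattern n w [1, 4, 2, 3] \<longleftrightarrow> (\<exists>a b c d. 1 \<le> a \<and> a < b \<and> b < c \<and> c < d \<and> d \<le> n \<and>
    w a < w c \<and> w c < w d \<and> w d < w b)" (is "?L \<longleftrightarrow> ?R")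
proof
  assume ?L
  then obtain "is" where idx: "length is = Suc (Suc (Suc (Suc 0)))" "sorted_wrt (<) is" "set is \<subseteq> {1..n}"
    "\<forall>a<4. \<forall>b<4. w (is ! a) < w (is ! b) \<longleftrightarrow> [1, 4, 2, 3::nat] ! a < [1, 4, 2, 3] ! b"
    unfolding contains_pattern_def by auto
  from idx(1) obtain a b c d where "is = [a, b, c, d]" by (auto simp: length_Suc_conv)
  moreover from this idx(2,3) have "1 \<le> a" "a < b" "b < c" "c < d" "d \<le> n" by auto
  ultimately have "1 \<le> a \<and> a < b \<and> b < c \<and> c < d \<and> d \<le> n \<and>
      w a < w c \<and> w c < w d \<and> w d < w b"
    using idx(4)[rule_format, of 0 2]
      idx(4)[rule_format, of 2 3]
      idx(4)[rule_format, of 3 1]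
    by simp
  then show ?R by blast
next
  assume ?R
  then obtain a b c d where "1 \<le> a" "a < b" "b < c" "c < d" "d \<le> n" "w a < w c" "w c < w d" "w d < w b"
    by blast
  then show ?L unfolding contains_pattern_def
    by (intro exI[of _ "[a, b, c, d]"]) (auto simp: All_less_Suc)
qed

lemma contains_13254_iff:
  "contains_pattern n w [1, 3, 2, 5, 4] \<longleftrightarrow> (\<exists>a b c d e. 1 \<le> a \<and> a < b \<and> b < c \<and> c < d \<and> d < e \<and>
    e \<le> n \<and> w a < w c \<and> w c < w b \<and> w b < w e \<and> w e < w d)" (is "?L \<longleftrightarrow> ?R")
proof
  assume ?L
  then obtain "is" where idx: "length is = Suc (Suc (Suc (Suc (Suc 0))))" "sorted_wrt (<) is"
    "set is \<subseteq> {1..n}"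
    "\<forall>a<5. \<forall>b<5. w (is ! a) < w (is ! b) \<longleftrightarrow> [1, 3, 2, 5, 4::nat] ! a < [1, 3, 2, 5, 4] ! b"
    unfolding contains_pattern_def by auto
  from idx(1) obtain a b c d e where "is = [a, b, c, d, e]" by (auto simp: length_Suc_conv)
  moreover from this idx(2,3) have "1 \<le> a" "a < b" "b < c" "c < d" "d < e" "e \<le> n" by auto
  ultimately have "1 \<le> a \<and> a < b \<and> b < c \<and> c < d \<and> d < e \<and> e \<le> n \<and>
      w a < w c \<and> w c < w b \<and> w b < w e \<and> w e < w d"
    using idx(4)[rule_format, of 0 2]
      idx(4)[rule_format, of 2 1]
      idx(4)[rule_format, of 1 4]
      idx(4)[rule_format, of 4 3]
    by simp
  then show ?R by blast
next
  assume ?R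
  then obtain a b c d e where "1 \<le> a" "a < b" "b < c" "c < d" "d < e" "e \<le> n"
    "w a < w c" "w c < w b" "w b < w e" "w e < w d" by blast
  then show ?L unfolding contains_pattern_def
    by (intro exI[of _ "[a, b, c, d, e]"]) (auto simp: All_less_Suc)
qed

lemma large_nonrecordsI:
  "k < s \<Longrightarrow> s < l \<Longrightarrow> l \<le> n \<Longrightarrow> w k < w l \<Longrightarrow> w l < w s \<Longrightarrow> l \<in> large_nonrecords n w k"
  by (auto simp: large_nonrecords_def)

lemma large_nonrecordsE:
  assumes "l \<in> large_nonrecords n w k"
  obtains s where "k < s" "s < l" "l \<le> n" "w k < w l" "w l < w s"
  using assms by (auto simp: large_nonrecords_def)

lemma two_large_nonrecordsI:
  assumes "c \<in> large_nonrecords n w a" "d \<in> large_nonrecords n w a" "c \<noteq> d"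
  shows "2 \<le> card (large_nonrecords n w a)"
proof -
  have "card {c, d} \<le> card (large_nonrecords n w a)" by (rule card_mono) (use assms in auto)
  with assms(3) show ?thesis by simp
qed

text \<open>Let c < d be large nonrecords of k, with larger earlier values at s and t. If w s
  exceeds w d, then s dominates both, which gives 1432 or 1423 according to the order of w c and w
  d. Otherwise w c < w s < w d < w t: if t is before c, then t dominates both and gives 1423; if t
  is after c, the positions k, s, c, t, d form 13254. The case t = c contradicts the order of the
  values.\<close>

lemma two_large_nonrecords_iff:
  assumes w: "w permutes {1..n}"
  shows "(\<exists>k\<in>{1..n}. 2 \<le> card (large_nonrecords n w k)) \<longleftrightarrow>
    contains_pattern n w [1, 4, 3, 2] \<or> contains_pattern n w [1, 4, 2, 3] \<or>
    contains_pattern n w [1, 3, 2, 5, 4]" (is "?L \<longleftrightarrow> ?R")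
proof
  have inj: "inj w" by (rule permutes_inj[OF w])
  assume ?L
  then obtain k where k: "k \<in> {1..n}" "2 \<le> card (large_nonrecords n w k)" by blast
  then obtain c d where cd: "c \<in> large_nonrecords n w k" "d \<in> large_nonrecords n w k" "c < d"
  proof -
    from k(2) have "\<not> card (large_nonrecords n w k) \<le> Suc 0" by simp
    then obtain c d where "c \<in> large_nonrecords n w k" "d \<in> large_nonrecords n w k" "c \<noteq> d"
      unfolding card_le_Suc0_iff_eq[OF finite_large_nonrecords] by blast
    then show thesis by (cases c d rule: linorder_cases) (simp_all add: that)
  qed
  obtain s where s: "k < s" "s < c" "w k < w c" "w c < w s" using cd(1) by (rule large_nonrecordsE)
  obtain t where t: "k < t" "t < d" "d \<le> n" "w k < w d" "w d < w t"
    using cd(2) by (rule large_nonrecordsE)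
  note st = s t
  have "c \<noteq> d" "s \<noteq> d" using s cd(3) by simp_all
  then have "w c \<noteq> w d" "w s \<noteq> w d" by (simp_all only: inj_eq[OF inj] not_False_eq_True)
  then have "w d < w s \<and> w d < w c \<or> w d < w s \<and> w c < w d \<or> w s < w d \<and> t < c \<or>
      w s < w d \<and> c < t \<or> w s < w d \<and> t = c"
    by linarith
  then consider "w d < w s" "w d < w c" | "w d < w s" "w c < w d" | "w s < w d" "t < c"
    | "w s < w d" "c < t" | "w s < w d" "t = c"
    by blast
  then show ?R
  proof cases
    case 1
    have "contains_pattern n w [1, 4, 3, 2]" unfolding contains_1432_iff
      by (rule exI[of _ k], rule exI[of _ s], rule exI[of _ c], rule exI[of _ d])
        (use 1 k(1) st cd(3) in auto)
    then show ?thesis by blast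
  next
    case 2
    have "contains_pattern n w [1, 4, 2, 3]" unfolding contains_1423_iff
      by (rule exI[of _ k], rule exI[of _ s], rule exI[of _ c], rule exI[of _ d])
        (use 2 k(1) st cd(3) in auto)
    then show ?thesis by blast
  next
    case 3
    have "contains_pattern n w [1, 4, 2, 3]" unfolding contains_1423_iff
      by (rule exI[of _ k], rule exI[of _ t], rule exI[of _ c], rule exI[of _ d])
        (use 3 k(1) st cd(3) in auto)
    then show ?thesis by blast
  next
    case 4
    have "contains_pattern n w [1, 3, 2, 5, 4]" unfolding contains_13254_iff
      by (rule exI[of _ k], rule exI[of _ s], rule exI[of _ c], rule exI[of _ t], rule exI[of _ d])
        (use 4 k(1) st cd(3) in auto)
    then show ?thesis by blast
  next
    case 5
    with st show ?thesis by simp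
  qed
next
  assume ?R
  then have "\<exists>a c d. 1 \<le> a \<and> a < c \<and> c < d \<and> d \<le> n \<and>
    c \<in> large_nonrecords n w a \<and> d \<in> large_nonrecords n w a"
  proof (elim disjE)
    assume "contains_pattern n w [1, 4, 3, 2]"
    then obtain a b c d where *: "1 \<le> a" "a < b" "b < c" "c < d" "d \<le> n"
      "w a < w d" "w d < w c" "w c < w b" unfolding contains_1432_iff by blast
    show ?thesis
      by (rule exI[of _ a], rule exI[of _ c], rule exI[of _ d])
        (use * large_nonrecordsI[of a b c n w] large_nonrecordsI[of a b d n w] in simp)
  next
    assume "contains_pattern n w [1, 4, 2, 3]"
    then obtain a b c d where *: "1 \<le> a" "a < b" "b < c" "c < d" "d \<le> n"
      "w a < w c" "w c < w d" "w d < w b" unfolding contains_1423_iff by blast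
    show ?thesis
      by (rule exI[of _ a], rule exI[of _ c], rule exI[of _ d])
        (use * large_nonrecordsI[of a b c n w] large_nonrecordsI[of a b d n w] in simp)
  next
    assume "contains_pattern n w [1, 3, 2, 5, 4]"
    then obtain a b c d e where *: "1 \<le> a" "a < b" "b < c" "c < d" "d < e" "e \<le> n"
      "w a < w c" "w c < w b" "w b < w e" "w e < w d" unfolding contains_13254_iff by blast
    show ?thesis
      by (rule exI[of _ a], rule exI[of _ c], rule exI[of _ e])
        (use * large_nonrecordsI[of a b c n w] large_nonrecordsI[of a d e n w] in simp)
  qed
  then obtain a c d where *: "1 \<le> a" "a < c" "c < d" "d \<le> n"
    "c \<in> large_nonrecords n w a" "d \<in> large_nonrecords n w a" by blast
  show ?L
    by (rule bexI[of _ a], rule two_large_nonrecordsI[OF *(5,6)]) (use * in simp_all)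
qed

section \<open>Lattice-free Newton polytopes\<close>

lemma lookup_scaleR [simp]:
  "Poly_Mapping.lookup (r *\<^sub>R x) i = r *\<^sub>R Poly_Mapping.lookup x i"
proof -
  have "finite {i. r *\<^sub>R Poly_Mapping.lookup x i \<noteq> 0}"
    by (rule finite_subset[OF _ finite_keys[of x]]) (auto simp: in_keys_iff)
  then show ?thesis by (simp add: scaleR_poly_mapping_def)
qed

lemma lookup_map_real [simp]:
  "Poly_Mapping.lookup (Poly_Mapping.map real x) i = real (Poly_Mapping.lookup x i)"
  by (simp add: map.rep_eq when_def)

text \<open>An integral coordinate of a point of the box is an endpoint of an interval of length 1,
  and a proper convex combination reaches an endpoint only if both of its points lie there. So no
  lattice point is inside a segment. Extreme points are integral because they are exponent
  vectors.\<close>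

lemma lattice_free_of_unit_box:
  assumes vars: "\<And>\<alpha>. \<alpha> \<in> Poly_Mapping.keys f \<Longrightarrow> Poly_Mapping.keys \<alpha> \<subseteq> {1..n}"
    and box: "\<And>\<alpha> i. \<alpha> \<in> Poly_Mapping.keys f \<Longrightarrow>
      m i \<le> Poly_Mapping.lookup \<alpha> i \<and> Poly_Mapping.lookup \<alpha> i \<le> m i + 1"
  shows "lattice_free n (Newton f)"
proof -
  let ?B = "{v :: nat \<Rightarrow>\<^sub>0 real. \<forall>i. real (m i) \<le> Poly_Mapping.lookup v i \<and>
    Poly_Mapping.lookup v i \<le> real (m i) + 1}"
  have "convex ?B"
  proof (rule convexI)
    fix x y :: "nat \<Rightarrow>\<^sub>0 real" and u v :: real
    assume xy: "x \<in> ?B" "y \<in> ?B" and uv: "0 \<le> u" "0 \<le> v" "u + v = 1"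
    have "real (m i) \<le> u * Poly_Mapping.lookup x i + v * Poly_Mapping.lookup y i" for i
    proof -
      have "u * real (m i) + v * real (m i) \<le> u * Poly_Mapping.lookup x i + v * Poly_Mapping.lookup y i"
        by (intro add_mono mult_left_mono) (use xy uv in auto)
      then show ?thesis using uv(3) by (simp flip: distrib_right)
    qed
    moreover have "u * Poly_Mapping.lookup x i + v * Poly_Mapping.lookup y i \<le> real (m i) + 1" for i
      by (rule convex_bound_le) (use xy uv in auto)
    ultimately show "u *\<^sub>R x + v *\<^sub>R y \<in> ?B" by (simp add: lookup_add)
  qed
  moreover have "Poly_Mapping.map real ` Poly_Mapping.keys f \<subseteq> ?B"
  proof (rule image_subsetI)
    fix \<alpha> assume "\<alpha> \<in> Poly_Mapping.keys f"
    then have "real (m i) \<le> real (Poly_Mapping.lookup \<alpha> i)"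
      "real (Poly_Mapping.lookup \<alpha> i) \<le> real (m i + 1)" for i
      using box[of \<alpha> i] by (simp_all only: of_nat_le_iff)
    then show "Poly_Mapping.map real \<alpha> \<in> ?B" by (simp add: add.commute)
  qed
  ultimately have sub: "Newton f \<subseteq> ?B" unfolding Newton_def by (intro hull_minimal)
  have "v extreme_point_of Newton f" if v: "v \<in> Newton f" "v \<in> integer_points n" for v
    unfolding extreme_point_of_def
  proof (intro conjI ballI notI)
    fix a b assume ab: "a \<in> Newton f" "b \<in> Newton f" "v \<in> open_segment a b"
    then obtain u where u: "a \<noteq> b" "0 < u" "u < 1" "v = (1 - u) *\<^sub>R a + u *\<^sub>R b"
      by (auto simp: in_segment)
    have "Poly_Mapping.lookup a i = Poly_Mapping.lookup b i" for i
    proof -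
      define x y z where "x = Poly_Mapping.lookup a i - m i" "y = Poly_Mapping.lookup b i - m i"
        "z = Poly_Mapping.lookup v i - m i"
      have "a \<in> ?B" "b \<in> ?B" "v \<in> ?B" using ab v sub by auto
      then have bounds: "0 \<le> x" "x \<le> 1" "0 \<le> y" "y \<le> 1" "0 \<le> z" "z \<le> 1"
        by (simp_all add: x_y_z_def algebra_simps)
      have z: "z = (1 - u) * x + u * y"
        by (simp add: x_y_z_def u(4) lookup_add) (simp add: algebra_simps)
      have "z \<in> \<int>" using v(2) by (auto simp: x_y_z_def integer_points_def)
      then obtain k where k: "z = of_int k" by (auto elim: Ints_cases)
      with bounds(5,6) have "k = 0 \<or> k = 1" by auto
      then show ?thesis
      proof
        assume "k = 0"
        then have "(1 - u) * x + u * y = 0" using z k by simp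
        moreover have "0 \<le> (1 - u) * x" "0 \<le> u * y" using u bounds by simp_all
        ultimately have "(1 - u) * x = 0" "u * y = 0" by linarith+
        with u show ?thesis by (simp add: x_y_z_def)
      next
        assume "k = 1"
        then have "(1 - u) * (1 - x) + u * (1 - y) = 0" using z k by (simp add: algebra_simps)
        moreover have "0 \<le> (1 - u) * (1 - x)" "0 \<le> u * (1 - y)" using u bounds by simp_all
        ultimately have "(1 - u) * (1 - x) = 0" "u * (1 - y) = 0" by linarith+
        with u show ?thesis by (simp add: x_y_z_def)
      qed
    qed
    then have "a = b" by (rule poly_mapping_eqI)
    with u(1) show False by simp
  qed (fact v)
  moreover have "v \<in> integer_points n" if "v extreme_point_of Newton f" for v
  proof -
    have "v \<in> Poly_Mapping.map real ` Poly_Mapping.keys f"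
      using that unfolding Newton_def by (rule extreme_point_of_convex_hull)
    then obtain \<alpha> where \<alpha>: "\<alpha> \<in> Poly_Mapping.keys f" "v = Poly_Mapping.map real \<alpha>" by auto
    then have "Poly_Mapping.keys v \<subseteq> {1..n}" using vars[OF \<alpha>(1)] by (auto simp: in_keys_iff)
    with \<alpha> show ?thesis by (simp add: integer_points_def)
  qed
  ultimately show ?thesis unfolding lattice_free_def by (auto simp: extreme_point_of_def)
qed

text \<open>\<beta> differs from \<alpha> by a multiple d of the integral vector e_i - e_j, and for
  d at least 2 the first step along it stays strictly inside the segment.\<close>

lemma not_lattice_free_of_swap:
  assumes keys: "\<alpha> \<in> Poly_Mapping.keys f" "\<beta> \<in> Poly_Mapping.keys f"
    and vars: "Poly_Mapping.keys \<alpha> \<subseteq> {1..n}" "Poly_Mapping.keys \<beta> \<subseteq> {1..n}"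
    and swap: "Poly_Mapping.lookup \<beta> = Poly_Mapping.lookup \<alpha> \<circ> Transposition.transpose i j"
    and gap: "Poly_Mapping.lookup \<alpha> i + 2 \<le> Poly_Mapping.lookup \<alpha> j"
  shows "\<not> lattice_free n (Newton f)"
proof
  assume lf: "lattice_free n (Newton f)"
  let ?a = "Poly_Mapping.map real \<alpha>" and ?b = "Poly_Mapping.map real \<beta>"
  define d where "d = real (Poly_Mapping.lookup \<alpha> j) - real (Poly_Mapping.lookup \<alpha> i)"
  have d: "2 \<le> d" using gap by (simp add: d_def)
  \<comment> \<open>The parameter 1 / d makes v equal to \<alpha> + e_i - e_j.\<close>
  define v where "v = (1 - 1 / d) *\<^sub>R ?a + (1 / d) *\<^sub>R ?b"
  have v_lookup: "Poly_Mapping.lookup v k = real (Poly_Mapping.lookup \<alpha> k) +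
      (if k = i then 1 else if k = j then - 1 else 0)" for k
  proof -
    have ij: "i \<noteq> j" using gap by auto
    have "Poly_Mapping.lookup v k = real (Poly_Mapping.lookup \<alpha> k) +
        (real (Poly_Mapping.lookup \<beta> k) - real (Poly_Mapping.lookup \<alpha> k)) / d"
      using d by (simp add: v_def lookup_add field_simps)
    moreover have "(real (Poly_Mapping.lookup \<beta> k) - real (Poly_Mapping.lookup \<alpha> k)) =
        (if k = i then d else if k = j then - d else 0)"
      using ij by (auto simp: swap d_def Transposition.transpose_def)
    ultimately show ?thesis using d by auto
  qed
  have ab: "?a \<in> Newton f" "?b \<in> Newton f" using keys by (auto simp: Newton_def intro: hull_inc)
  have "?a \<noteq> ?b"
  proof
    assume "?a = ?b"
    then have "Poly_Mapping.lookup ?a i = Poly_Mapping.lookup ?b i" by simp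
    with gap show False by (simp add: swap)
  qed
  then have seg: "v \<in> open_segment ?a ?b"
    unfolding in_segment v_def using d by (intro conjI exI[of _ "1 / d"]) simp_all
  have "v \<in> Newton f"
    using ab d unfolding v_def Newton_def by (intro convexD[OF convex_convex_hull]) auto
  moreover have "v \<in> integer_points n"
    unfolding integer_points_def
  proof (intro CollectI conjI allI subsetI)
    fix k assume "k \<in> Poly_Mapping.keys v"
    then have "k \<in> Poly_Mapping.keys \<alpha> \<or> k \<in> Poly_Mapping.keys \<beta>"
      by (auto simp: in_keys_iff v_def lookup_add)
    with vars show "k \<in> {1..n}" by blast
  next
    fix k show "Poly_Mapping.lookup v k \<in> \<int>" unfolding v_lookup by simp
  qed
  ultimately have "v extreme_point_of Newton f" using lf by (auto simp: lattice_free_def)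
  with ab seg show False by (auto simp: extreme_point_of_def)
qed

text \<open>A nonrecord is split off by comparison with w k. If its value is larger, its witness
  cannot be k, so it lies strictly after k and makes the position a large nonrecord.\<close>

lemma card_nonrecords_le:
  assumes "inj w" "k \<le> j"
  shows "card (nonrecords n w j) \<le> code n w k + card (large_nonrecords n w k)"
proof -
  let ?S = "{l. k < l \<and> l \<le> n \<and> w l < w k}"
  have fin: "finite ?S" by (rule finite_subset[of _ "{..n}"]) auto
  have "nonrecords n w j \<subseteq> ?S \<union> large_nonrecords n w k"
  proof
    fix l assume "l \<in> nonrecords n w j"
    then obtain s where s: "j < l" "l \<le> n" "j \<le> s" "s < l" "w l < w s" by (rule nonrecordsE)
    show "l \<in> ?S \<union> large_nonrecords n w k"
    proof (cases "w l < w k")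
      case True
      with s assms(2) show ?thesis by simp
    next
      case False
      have "k \<noteq> l" using s assms(2) by simp
      then have "w k \<noteq> w l" using assms(1) by (simp add: inj_eq)
      with False have "w k < w l" by simp
      moreover from this s have "k \<noteq> s" by auto
      ultimately have "l \<in> large_nonrecords n w k"
        using s assms(2) by (intro large_nonrecordsI[of k s]) auto
      then show ?thesis ..
    qed
  qed
  then have "card (nonrecords n w j) \<le> card (?S \<union> large_nonrecords n w k)"
    by (intro card_mono) (use fin in auto)
  also have "\<dots> \<le> code n w k + card (large_nonrecords n w k)"
    unfolding code_def by (rule card_Un_le)
  finally show ?thesis .
qed

theorem theorem5p4:
  fixes n :: nat and w :: "nat \<Rightarrow> nat"
  assumes "w permutes {1..n}"
  shows "lattice_free n (Newton (grothendieck n w)) \<longleftrightarrow>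
    avoids_pattern n w [1, 4, 3, 2] \<and>
    avoids_pattern n w [1, 4, 2, 3] \<and>
    avoids_pattern n w [1, 3, 2, 5, 4]"
proof -
  let ?g = "grothendieck n w"
  have inj: "inj w" by (rule permutes_inj[OF assms])
  have coeff: "coeff_at ?g (Poly_Mapping.lookup \<alpha>) \<noteq> 0" if "\<alpha> \<in> Poly_Mapping.keys ?g" for \<alpha>
    using that by (simp add: coeff_at_lookup in_keys_iff)
  have vars: "Poly_Mapping.keys \<alpha> \<subseteq> {1..n}" if "\<alpha> \<in> Poly_Mapping.keys ?g" for \<alpha>
  proof
    fix k assume "k \<in> Poly_Mapping.keys \<alpha>"
    then have "Poly_Mapping.lookup \<alpha> k \<noteq> 0" by (simp add: in_keys_iff)
    from this grothendieck_support_vars[OF assms coeff[OF that]] show "k \<in> {1..n}"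
      by (rule contrapos_np)
  qed
  have "lattice_free n (Newton ?g)" if small: "\<And>k. k \<in> {1..n} \<Longrightarrow> card (large_nonrecords n w k) \<le> 1"
  proof (rule lattice_free_of_unit_box[OF vars])
    fix \<alpha> i assume \<alpha>: "\<alpha> \<in> Poly_Mapping.keys ?g"
    \<comment> \<open>Outside {1..n} the exponents vanish, so the box may start at 0 there.\<close>
    let ?m = "\<lambda>i. if i \<in> {1..n} then Min (code n w ` {1..i}) else 0"
    show "?m i \<le> Poly_Mapping.lookup \<alpha> i \<and> Poly_Mapping.lookup \<alpha> i \<le> ?m i + 1"
    proof (cases "i \<in> {1..n}")
      case False
      then have "Poly_Mapping.lookup \<alpha> i = 0"
        by (rule grothendieck_support_vars[OF assms coeff[OF \<alpha>]])
      with False show ?thesis by (simp only: if_False le0 simp_thms)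
    next
      case True
      let ?M = "Min (code n w ` {1..i})"
      \<comment> \<open>The index that attains the minimum is also the one put into the upper bound,
        so both bounds refer to the same code entry and differ by at most q_k \<le> 1.\<close>
      have "?M \<in> code n w ` {1..i}" by (rule Min_in) (use True in auto)
      then obtain k where k: "k \<in> {1..i}" "code n w k = ?M" by auto
      obtain l where l: "l \<in> {1..i}" "code n w l \<le> Poly_Mapping.lookup \<alpha> i"
        using grothendieck_support_lower[OF assms coeff[OF \<alpha>] True] by blast
      have "?M \<le> code n w l" by (rule Min_le) (use l in auto)
      then have "?M \<le> Poly_Mapping.lookup \<alpha> i" using l(2) by (rule order_trans)
      have "Poly_Mapping.lookup \<alpha> i \<le> card (nonrecords n w i)"
        by (rule grothendieck_support_upper[OF assms coeff[OF \<alpha>]]) (use True in auto)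
      also have "\<dots> \<le> code n w k + card (large_nonrecords n w k)"
        by (rule card_nonrecords_le[OF inj]) (use k in simp)
      also have "\<dots> \<le> code n w k + 1" using small[of k] k True by simp
      finally have "Poly_Mapping.lookup \<alpha> i \<le> ?M + 1" unfolding k(2) .
      with \<open>?M \<le> Poly_Mapping.lookup \<alpha> i\<close> True show ?thesis by (simp only: if_True simp_thms)
    qed
  qed
  moreover have "\<not> lattice_free n (Newton ?g)"
    if "\<exists>k\<in>{1..n}. 2 \<le> card (large_nonrecords n w k)"
  proof -
    let ?K = "{k\<in>{1..n}. 2 \<le> card (large_nonrecords n w k)}"
    define k where "k = Max ?K"
    have "k \<in> ?K" unfolding k_def by (rule Max_in) (use that in auto)
    then have k: "1 \<le> k" "k \<le> n" "2 \<le> card (large_nonrecords n w k)" by auto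
    have max: "l \<le> k" if "l \<in> ?K" for l unfolding k_def by (rule Max_ge) (use that in auto)
    have kn: "k < n"
    proof -
      have "large_nonrecords n w k \<noteq> {}" using k(3) by auto
      then obtain l where "l \<in> large_nonrecords n w k" by blast
      then show ?thesis by (rule large_nonrecordsE) simp
    qed
    \<comment> \<open>At a descent, a witness s for a large nonrecord l of k satisfies w s > w l > w
      k > w (k + 1), so s is not k + 1. All large nonrecords of k would then belong to k + 1 as
      well, against the maximality of k.\<close>
    have ascent: "w k < w (k + 1)"
    proof (rule ccontr)
      assume "\<not> w k < w (k + 1)"
      moreover have "w k \<noteq> w (k + 1)" using inj by (simp add: inj_eq)
      ultimately have desc: "w (k + 1) < w k" by simp
      have "large_nonrecords n w k \<subseteq> large_nonrecords n w (k + 1)"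
      proof
        fix l assume "l \<in> large_nonrecords n w k"
        then obtain s where s: "k < s" "s < l" "l \<le> n" "w k < w l" "w l < w s"
          by (rule large_nonrecordsE)
        with desc have "s \<noteq> k + 1" by auto
        with s desc show "l \<in> large_nonrecords n w (k + 1)"
          by (intro large_nonrecordsI[of "k + 1" s]) auto
      qed
      then have "card (large_nonrecords n w k) \<le> card (large_nonrecords n w (k + 1))"
        by (intro card_mono) auto
      then have "k + 1 \<in> ?K" using k kn by simp
      from max[OF this] show False by simp
    qed
    \<comment> \<open>The later values below w k are nonrecords from k + 1 on because w (k + 1)
      exceeds w k, and the large nonrecords keep their witnesses. The two sets are disjoint, so
      U_{k+1} is at least c_k + q_k.\<close>
    have large: "code n w k + 2 \<le> card (nonrecords n w (k + 1))"
    proof -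
      let ?S = "{l. k < l \<and> l \<le> n \<and> w l < w k}"
      have fin: "finite ?S" by (rule finite_subset[of _ "{..n}"]) auto
      have "?S \<subseteq> nonrecords n w (k + 1)"
      proof
        fix l assume l: "l \<in> ?S"
        with ascent have "l \<noteq> k + 1" by auto
        with l ascent show "l \<in> nonrecords n w (k + 1)"
          by (intro nonrecordsI[of _ _ _ "k + 1"]) auto
      qed
      moreover have "large_nonrecords n w k \<subseteq> nonrecords n w (k + 1)"
      proof
        fix l assume "l \<in> large_nonrecords n w k"
        then obtain s where "k < s" "s < l" "l \<le> n" "w l < w s" by (rule large_nonrecordsE)
        then show "l \<in> nonrecords n w (k + 1)" by (intro nonrecordsI[of _ _ _ s]) auto
      qed
      ultimately have "card (?S \<union> large_nonrecords n w k) \<le> card (nonrecords n w (k + 1))"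
        by (intro card_mono) auto
      moreover have "card (?S \<union> large_nonrecords n w k) = code n w k + card (large_nonrecords n w k)"
        unfolding code_def using fin
        by (intro card_Un_disjoint) (auto simp: large_nonrecords_def)
      ultimately show ?thesis using k(3) by linarith
    qed
    obtain \<alpha>' where \<alpha>': "coeff_at ?g \<alpha>' \<noteq> 0" "\<alpha>' k = code n w k"
      "\<alpha>' (k + 1) = card (nonrecords n w (k + 1))"
    proof (rule grothendieck_support_extremal[OF assms, of "k + 1"])
      fix \<alpha>' assume "coeff_at ?g \<alpha>' \<noteq> 0" "\<And>l. l \<in> {1..<k + 1} \<Longrightarrow> \<alpha>' l = code n w l"
        "\<alpha>' (k + 1) = card (nonrecords n w (k + 1))"
      with k(1) show thesis by (intro that[of \<alpha>']) auto
    qed (use kn in auto)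
    obtain \<alpha> where \<alpha>: "\<alpha>' = Poly_Mapping.lookup \<alpha>" "\<alpha> \<in> Poly_Mapping.keys ?g"
      using \<alpha>'(1) by (rule coeff_at_nonzeroE)
    have "coeff_at ?g (\<alpha>' \<circ> Transposition.transpose k (k + 1)) \<noteq> 0"
      using \<alpha>'(1) by (simp only: grothendieck_swap[OF assms k(1) kn ascent] simp_thms)
    then obtain \<beta> where \<beta>: "\<alpha>' \<circ> Transposition.transpose k (k + 1) = Poly_Mapping.lookup \<beta>"
      "\<beta> \<in> Poly_Mapping.keys ?g" by (rule coeff_at_nonzeroE)
    show ?thesis
      by (rule not_lattice_free_of_swap[OF \<alpha>(2) \<beta>(2) vars[OF \<alpha>(2)] vars[OF \<beta>(2)]
            \<beta>(1)[symmetric, unfolded \<alpha>(1)]])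
        (use \<alpha>' large in \<open>simp add: \<alpha>(1)\<close>)
  qed
  moreover have "(\<forall>k\<in>{1..n}. card (large_nonrecords n w k) \<le> 1) \<longleftrightarrow>
      \<not> (\<exists>k\<in>{1..n}. 2 \<le> card (large_nonrecords n w k))"
    by (auto simp: not_le less_Suc_eq_le numeral_2_eq_2)
  ultimately show ?thesis using two_large_nonrecords_iff[OF assms] by blast
qed

end
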